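(* Let $K$ be a convex set in a real or complex linear topological space $\mathbb{X}$, and suppose that there exists a continuous linear functional on $\mathbb{X}$ that is non-constant on $K$. Then, for every non-empty compact convex set $\mathbb{T}\subset\mathbb{R}^2$, there exists a continuous surjection $h\colon\mathbb{X}\to\mathbb{T}$ such that $h(L)$ is convex for every convex subset $L\subset K$, and $h(K)=\mathbb{T}$.
   Context: A linear topological space is a topological vector space over $\mathbb{R}$ or $\mathbb{C}$. *)

theory Defs
  imports "HOL-Analysis.Analysis"
begin

text \<open>
  Joint continuity of addition is inherited from \<^class>\<open>topological_monoid_add\<close>; negation is
  then continuous as scaling by \<open>-1\<close>. No separation axiom is imposed.
\<close>

class real_linear_topological_space = real_vector + topological_monoid_add +
  assumes tendsto_scaleR_Pair: "LIM p (nhds r \<times>\<^sub>F nhds x). fst p *\<^sub>R snd p :> nhds (r *\<^sub>R x)"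

instance real_normed_vector \<subseteq> real_linear_topological_space
proof
  fix r :: real and x :: 'a
  show "LIM p (nhds r \<times>\<^sub>F nhds x). fst p *\<^sub>R snd p :> nhds (r *\<^sub>R x)"
    by (intro tendsto_scaleR filterlim_fst filterlim_snd)
qed

text \<open>
  A complex vector space carries the real structure obtained by restricting its scalars
  (\<open>scaleR_scaleC\<close>), so that \<^const>\<open>convex\<close> is meaningful in it.
\<close>

class scaleC = scaleR +
  fixes scaleC :: "complex \<Rightarrow> 'a \<Rightarrow> 'a" (infixr "*\<^sub>C" 75)
  assumes scaleR_scaleC: "r *\<^sub>R x = complex_of_real r *\<^sub>C x"

class complex_vector = scaleC + ab_group_add +
  assumes scaleC_add_right: "a *\<^sub>C (x + y) = a *\<^sub>C x + a *\<^sub>C y"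
    and scaleC_add_left: "(a + b) *\<^sub>C x = a *\<^sub>C x + b *\<^sub>C x"
    and scaleC_scaleC: "a *\<^sub>C b *\<^sub>C x = (a * b) *\<^sub>C x"
    and scaleC_one: "1 *\<^sub>C x = x"
begin

subclass real_vector
  by standard
    (simp_all add: scaleR_scaleC scaleC_add_right scaleC_add_left scaleC_scaleC scaleC_one)

end

class complex_linear_topological_space = complex_vector + topological_monoid_add +
  assumes tendsto_scaleC_Pair: "LIM p (nhds c \<times>\<^sub>F nhds x). fst p *\<^sub>C snd p :> nhds (c *\<^sub>C x)"

instance complex_linear_topological_space \<subseteq> real_linear_topological_space
proof
  fix r :: real and x :: 'a
  have "((\<lambda>p. complex_of_real (fst p)) \<longlongrightarrow> complex_of_real r) (nhds r \<times>\<^sub>F nhds x)"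
    by (intro tendsto_of_real filterlim_fst)
  then have "LIM p (nhds r \<times>\<^sub>F nhds x). (complex_of_real (fst p), snd p)
      :> nhds (complex_of_real r) \<times>\<^sub>F nhds x"
    by (intro filterlim_Pair filterlim_snd)
  from filterlim_compose[OF tendsto_scaleC_Pair this]
  show "LIM p (nhds r \<times>\<^sub>F nhds x). fst p *\<^sub>R snd p :> nhds (r *\<^sub>R x)"
    by (simp add: scaleR_scaleC)
qed

instantiation complex :: complex_linear_topological_space
begin

definition scaleC_complex :: "complex \<Rightarrow> complex \<Rightarrow> complex"
  where "scaleC_complex = (*)"

instance
proof
  fix c x :: complex
  show "LIM p (nhds c \<times>\<^sub>F nhds x). fst p *\<^sub>C snd p :> nhds (c *\<^sub>C x)"
    unfolding scaleC_complex_def by (intro tendsto_mult filterlim_fst filterlim_snd)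
qed (simp_all add: scaleC_complex_def scaleR_conv_of_real algebra_simps)

end

abbreviation clinear :: "('a::complex_vector \<Rightarrow> 'b::complex_vector) \<Rightarrow> bool"
  where "clinear \<equiv> Vector_Spaces.linear scaleC scaleC"

end

theory Submission
  imports Defs
begin

text \<open>
  Composing with the functional, it suffices to find a continuous curve onto \<open>T\<close> that maps every
  parameter interval to a convex set. Such a curve is a limit of chains: finite sequences of compact
  convex sets in which every union of consecutive members is convex. A chain is refined as follows.
  First all members are bulged slightly, which preserves the chain property and makes all the unions
  strictly convex. A strictly convex body can grow through convex sets with increments of small
  diameter; intersecting with such growing bodies, each member is made to grow out of its overlap
  with its predecessor and to shrink to its overlap with its successor, again by small increments.
  A strip sweeping back and forth, with the increments taking place inside it, then cuts the sets
  into thin pieces, since the union of consecutive pieces is the union of the sets intersected with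
  the union of the strips. The limit curve covers \<open>T\<close>, and its excursions outside \<open>T\<close> are then
  replaced by constant paths.
\<close>

subsection \<open>Bulging and strict convexity\<close>

text \<open>The obstacle is that cutting the members of a chain independently destroys the convexity
  of the unions: a union of sets \<open>C t \<inter> J t\<close> is in general smaller than the
  intersection of the two unions. They agree if every point enters or leaves the sets inside the
  current strip, so each change from one set to the next must have a diameter comparable to the
  width of a strip. Flat faces forbid such slow growth, since a convex set that reaches beyond a
  face at once gains points near all points of that face; strict convexity is there to exclude this.
  Moreover, a run of bulged members has to be the bulged run, so bulging must commute with unions;
  therefore the radius in \<open>bulge\<close> depends on the centre \<open>x\<close> alone and not
  on the set. Bulging makes the cells leave \<open>T\<close> and partly undoes the thinness reached
  before, so each round works with a tolerance of its own, and geometrically decreasing tolerances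
  make the cells converge to a curve.\<close>

definition strictly_convex :: "'a::real_normed_vector set \<Rightarrow> bool" where
  "strictly_convex S \<longleftrightarrow> (\<forall>x\<in>S. \<forall>y\<in>S. x \<noteq> y \<longrightarrow> midpoint x y \<in> interior S)"

text \<open>For \<open>c = 0\<close> and \<open>r \<ge> 0\<close> this is the union of the closed
  balls of radius \<open>r\<close> around the points of \<open>K\<close>, which keeps flat faces
  flat. For \<open>c > 0\<close> the ball around \<open>x\<close> has squared radius
  \<open>r\<^sup>2 - c * (norm x)\<^sup>2\<close>, a strictly concave function of \<open>x\<close>,
  and the faces become curved.\<close>

definition bulge :: "real \<Rightarrow> real \<Rightarrow> 'a::real_normed_vector set \<Rightarrow> 'a set" where
  "bulge r c K = {y. \<exists>x\<in>K. (norm (y - x))\<^sup>2 + c * (norm x)\<^sup>2 \<le> r\<^sup>2}"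

lemma bulge_UN: "bulge r c (\<Union>i\<in>I. F i) = (\<Union>i\<in>I. bulge r c (F i))"
  by (auto simp: bulge_def)

lemma norm_convex_combination_sq:
  fixes u v :: "'a::real_inner"
  assumes "s + t = 1"
  shows "(norm (s *\<^sub>R u + t *\<^sub>R v))\<^sup>2 = s * (norm u)\<^sup>2 + t * (norm v)\<^sup>2 - s * t * (norm (u - v))\<^sup>2"
proof -
  have s: "s = 1 - t" using assms by simp
  show ?thesis
    unfolding s power2_norm_eq_inner
    by (simp add: inner_add_left inner_add_right inner_diff_left inner_diff_right
        inner_commute algebra_simps)
qed

text \<open>Both terms are squared norms, so the identity for convex combinations leaves a deficit
  made of the distance of the offsets and the distance of the centres. Its sign gives convexity; its
  strict positivity at \<open>s = t = 1/2\<close> gives strict convexity.\<close>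

lemma bulge_combination:
  fixes x y x' y' :: "'a::real_inner"
  assumes "s + t = 1" "s \<ge> 0" "t \<ge> 0"
    and "(norm (y - x))\<^sup>2 + c * (norm x)\<^sup>2 \<le> r\<^sup>2" "(norm (y' - x'))\<^sup>2 + c * (norm x')\<^sup>2 \<le> r\<^sup>2"
  shows "(norm ((s *\<^sub>R y + t *\<^sub>R y') - (s *\<^sub>R x + t *\<^sub>R x')))\<^sup>2 + c * (norm (s *\<^sub>R x + t *\<^sub>R x'))\<^sup>2
    \<le> r\<^sup>2 - s * t * ((norm ((y - x) - (y' - x')))\<^sup>2 + c * (norm (x - x'))\<^sup>2)"
proof -
  have 1: "(s *\<^sub>R y + t *\<^sub>R y') - (s *\<^sub>R x + t *\<^sub>R x') = s *\<^sub>R (y - x) + t *\<^sub>R (y' - x')"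
    by (simp add: algebra_simps)
  have "s * ((norm (y - x))\<^sup>2 + c * (norm x)\<^sup>2) + t * ((norm (y' - x'))\<^sup>2 + c * (norm x')\<^sup>2)
      \<le> s * r\<^sup>2 + t * r\<^sup>2"
    using assms by (intro add_mono mult_left_mono) auto
  also have "\<dots> = r\<^sup>2" using assms(1) by (simp flip: distrib_right)
  finally show ?thesis
    unfolding 1 norm_convex_combination_sq[OF assms(1)] by (simp add: algebra_simps)
qed

lemma convex_bulge:
  fixes K :: "'a::real_inner set"
  assumes "convex K" "c \<ge> 0"
  shows "convex (bulge r c K)"
proof (rule convexI)
  fix y y' and s t :: real
  assume y: "y \<in> bulge r c K" "y' \<in> bulge r c K" and st: "0 \<le> s" "0 \<le> t" "s + t = 1"
  obtain x x' where x: "x \<in> K" "(norm (y - x))\<^sup>2 + c * (norm x)\<^sup>2 \<le> r\<^sup>2"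
      "x' \<in> K" "(norm (y' - x'))\<^sup>2 + c * (norm x')\<^sup>2 \<le> r\<^sup>2"
    using y by (auto simp: bulge_def)
  have "0 \<le> s * t * ((norm ((y - x) - (y' - x')))\<^sup>2 + c * (norm (x - x'))\<^sup>2)"
    using st assms by simp
  then have "(norm ((s *\<^sub>R y + t *\<^sub>R y') - (s *\<^sub>R x + t *\<^sub>R x')))\<^sup>2 + c * (norm (s *\<^sub>R x + t *\<^sub>R x'))\<^sup>2 \<le> r\<^sup>2"
    using bulge_combination[OF st(3,1,2) x(2) x(4)] by linarith
  moreover have "s *\<^sub>R x + t *\<^sub>R x' \<in> K" using assms(1) x st by (auto simp: convex_def)
  ultimately show "s *\<^sub>R y + t *\<^sub>R y' \<in> bulge r c K" unfolding bulge_def by blast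
qed

lemma bulge_interiorI:
  fixes K :: "'a::real_normed_vector set"
  assumes "x \<in> K" "(norm (y - x))\<^sup>2 + c * (norm x)\<^sup>2 < r\<^sup>2"
  shows "y \<in> interior (bulge r c K)"
proof -
  let ?V = "{y. (norm (y - x))\<^sup>2 + c * (norm x)\<^sup>2 < r\<^sup>2}"
  have "open ?V" by (intro open_Collect_less continuous_intros)
  moreover have "?V \<subseteq> bulge r c K" using assms(1) by (force simp: bulge_def)
  ultimately show ?thesis using assms(2) by (auto simp: interior_def)
qed

lemma strictly_convex_bulge:
  fixes K :: "'a::real_inner set"
  assumes "convex K" "c > 0"
  shows "strictly_convex (bulge r c K)"
  unfolding strictly_convex_def
proof (intro ballI impI)
  fix y y' assume y: "y \<in> bulge r c K" "y' \<in> bulge r c K" and ne: "y \<noteq> y'"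
  obtain x x' where x: "x \<in> K" "(norm (y - x))\<^sup>2 + c * (norm x)\<^sup>2 \<le> r\<^sup>2"
      "x' \<in> K" "(norm (y' - x'))\<^sup>2 + c * (norm x')\<^sup>2 \<le> r\<^sup>2"
    using y by (auto simp: bulge_def)
  have "0 < (norm ((y - x) - (y' - x')))\<^sup>2 + c * (norm (x - x'))\<^sup>2"
  proof (cases "x = x'")
    case True then show ?thesis using ne by simp
  next
    case False then show ?thesis using assms by (intro add_nonneg_pos) auto
  qed
  moreover have half: "(1/2::real) + 1/2 = 1" "(0::real) \<le> 1/2" by simp_all
  note bulge_combination[OF half half(2) x(2) x(4)]
  moreover have "L < R" if "0 < a" "L \<le> R - 1/2 * (1/2) * a" for a L R :: real
    using that by linarith
  ultimately have "(norm (((1/2) *\<^sub>R y + (1/2) *\<^sub>R y') - ((1/2) *\<^sub>R x + (1/2) *\<^sub>R x')))\<^sup>2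
      + c * (norm ((1/2) *\<^sub>R x + (1/2) *\<^sub>R x'))\<^sup>2 < r\<^sup>2"
    by blast
  moreover have "(1/2) *\<^sub>R x + (1/2) *\<^sub>R x' \<in> K" using assms(1) x by (auto simp: convex_def)
  moreover have "midpoint y y' = (1/2) *\<^sub>R y + (1/2) *\<^sub>R y'"
    by (simp add: midpoint_def algebra_simps)
  ultimately show "midpoint y y' \<in> interior (bulge r c K)" using bulge_interiorI by metis
qed

text \<open>The bulge is the image under addition of a compact set of pairs of a centre and an
  offset.\<close>

lemma compact_bulge:
  fixes K :: "'a::euclidean_space set"
  assumes "compact K" "c \<ge> 0" "r \<ge> 0"
  shows "compact (bulge r c K)"
proof -
  let ?f = "\<lambda>p::'a \<times> 'a. fst p + snd p"
  let ?S = "(K \<times> cball (0::'a) r) \<inter> {p. (norm (snd p))\<^sup>2 + c * (norm (fst p))\<^sup>2 \<le> r\<^sup>2}"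
  have "closed {p::'a\<times>'a. (norm (snd p))\<^sup>2 + c * (norm (fst p))\<^sup>2 \<le> r\<^sup>2}"
    by (intro closed_Collect_le continuous_intros)
  then have "compact ?S" using assms(1) by (intro compact_Int_closed compact_Times compact_cball)
  then have "compact (?f ` ?S)" by (intro compact_continuous_image continuous_intros)
  moreover have "bulge r c K = ?f ` ?S"
  proof (intro equalityI subsetI)
    fix y assume "y \<in> bulge r c K"
    then obtain x where x: "x \<in> K" "(norm (y - x))\<^sup>2 + c * (norm x)\<^sup>2 \<le> r\<^sup>2" by (auto simp: bulge_def)
    moreover have "0 \<le> c * (norm x)\<^sup>2" using assms by simp
    ultimately have "(norm (y - x))\<^sup>2 \<le> r\<^sup>2" by linarith
    then have "norm (y - x) \<le> r" using assms power2_le_imp_le by blast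
    with x have "(x, y - x) \<in> ?S" by simp
    then show "y \<in> ?f ` ?S" by (rule rev_image_eqI) simp
  qed (auto simp: bulge_def intro!: bexI)
  ultimately show ?thesis by simp
qed

lemma bulge_subset_cballs:
  assumes "c \<ge> 0" "r \<ge> 0"
  shows "bulge r c K \<subseteq> (\<Union>x\<in>K. cball x r)"
proof
  fix y assume "y \<in> bulge r c K"
  then obtain x where x: "x \<in> K" "(norm (y - x))\<^sup>2 + c * (norm x)\<^sup>2 \<le> r\<^sup>2" by (auto simp: bulge_def)
  moreover have "0 \<le> c * (norm x)\<^sup>2" using assms by simp
  ultimately have "(norm (y - x))\<^sup>2 \<le> r\<^sup>2" by linarith
  then have "norm (y - x) \<le> r" using assms power2_le_imp_le by blast
  then show "y \<in> (\<Union>x\<in>K. cball x r)" using x by (auto simp: dist_norm norm_minus_commute)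
qed

text \<open>If this failed for every \<open>\<eta> = 1/(n + 1)\<close>, a limit would yield two
  points at distance at least \<open>e\<close> that both maximise the same functional
  \<open>u\<close> over \<open>X\<close>. Their midpoint is interior and can be pushed further in
  direction \<open>u\<close>, a contradiction. The tolerance is multiplicative because the caps will
  arise from a dilation about the origin.\<close>

lemma small_caps:
  fixes X :: "'a::euclidean_space set"
  assumes X: "compact X" "strictly_convex X" and e: "e > 0"
  shows "\<exists>\<eta>>0. \<forall>x\<in>X. \<forall>y\<in>X. \<forall>u v. norm u = 1 \<and> norm v = 1 \<and> dist u v \<le> \<eta>
    \<and> (\<forall>z\<in>X. z \<bullet> u \<le> (1 + \<eta>) * (x \<bullet> u)) \<and> (\<forall>z\<in>X. z \<bullet> v \<le> (1 + \<eta>) * (y \<bullet> v)) \<longrightarrow> dist x y \<le> e"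
proof (rule ccontr)
  assume neg: "\<not> ?thesis"
  define C where "C \<eta> x y u v \<longleftrightarrow> norm u = 1 \<and> norm v = 1 \<and> dist u v \<le> \<eta>
    \<and> (\<forall>z\<in>X. z \<bullet> u \<le> (1 + \<eta>) * (x \<bullet> u)) \<and> (\<forall>z\<in>X. z \<bullet> v \<le> (1 + \<eta>) * (y \<bullet> v))" for \<eta> x y u v
  define P where "P n x y u v \<longleftrightarrow> x \<in> X \<and> y \<in> X \<and> C (inverse (real (Suc n))) x y u v \<and> \<not> dist x y \<le> e"
    for n x y u v
  have neg': "\<not> (\<exists>\<eta>>0. \<forall>x\<in>X. \<forall>y\<in>X. \<forall>u v. C \<eta> x y u v \<longrightarrow> dist x y \<le> e)"
    unfolding C_def by (fact neg)
  have "\<exists>x y u v. P n x y u v" for n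
  proof -
    have "inverse (real (Suc n)) > 0" by simp
    with neg' show ?thesis unfolding P_def by blast
  qed
  then obtain x' y' u' v' where p: "\<And>n. P n (x' n) (y' n) (u' n) (v' n)"
    by metis
  have px: "x' n \<in> X" "y' n \<in> X" "norm (u' n) = 1" "norm (v' n) = 1" "dist (u' n) (v' n) \<le> inverse (real (Suc n))"
    "z \<in> X \<Longrightarrow> z \<bullet> u' n \<le> (1 + inverse (real (Suc n))) * (x' n \<bullet> u' n)"
    "z \<in> X \<Longrightarrow> z \<bullet> v' n \<le> (1 + inverse (real (Suc n))) * (y' n \<bullet> v' n)" "e \<le> dist (x' n) (y' n)" for n z
    using p[of n] unfolding P_def C_def by (blast, blast, blast, blast, blast, blast, blast, linarith)
  define p where "p n = (x' n, y' n, u' n, v' n)" for n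
  have "seq_compact (X \<times> X \<times> sphere (0::'a) 1 \<times> sphere (0::'a) 1)"
    using X by (intro compact_imp_seq_compact compact_Times compact_sphere)
  moreover have "\<forall>n. p n \<in> X \<times> X \<times> sphere (0::'a) 1 \<times> sphere (0::'a) 1"
    by (simp add: p_def px)
  ultimately obtain l r where l: "l \<in> X \<times> X \<times> sphere (0::'a) 1 \<times> sphere (0::'a) 1"
    and r: "strict_mono r" and lim: "(p \<circ> r) \<longlonglongrightarrow> l"
    by (rule seq_compactE)
  obtain x y u v where lxy: "l = (x, y, u, v)" by (rule prod_cases4)
  have q: "(\<lambda>n. x' (r n)) \<longlonglongrightarrow> x" "(\<lambda>n. y' (r n)) \<longlonglongrightarrow> y"
    "(\<lambda>n. u' (r n)) \<longlonglongrightarrow> u" "(\<lambda>n. v' (r n)) \<longlonglongrightarrow> v"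
    using tendsto_fst[OF lim] tendsto_fst[OF tendsto_snd[OF lim]]
      tendsto_fst[OF tendsto_snd[OF tendsto_snd[OF lim]]]
      tendsto_snd[OF tendsto_snd[OF tendsto_snd[OF lim]]] by (simp_all add: lxy o_def p_def)
  have inv: "(\<lambda>n. inverse (real (Suc (r n)))) \<longlonglongrightarrow> 0"
    using LIMSEQ_subseq_LIMSEQ[OF LIMSEQ_inverse_real_of_nat r] by (simp add: o_def)
  have "dist u v \<le> 0"
    by (rule LIMSEQ_le[OF tendsto_dist[OF q(3,4)] inv]) (use px in blast)
  then have uv: "v = u" by simp
  have "\<exists>N. \<forall>n\<ge>N. e \<le> dist (x' (r n)) (y' (r n))"
    using px by blast
  then have dxy: "dist x y \<ge> e"
    by (rule LIMSEQ_le_const[OF tendsto_dist[OF q(1,2)]])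
  have mx: "z \<bullet> u \<le> x \<bullet> u" "z \<bullet> u \<le> y \<bullet> u" if z: "z \<in> X" for z
  proof -
    have "z \<bullet> u \<le> (1 + 0) * (x \<bullet> u)"
      by (rule LIMSEQ_le[OF tendsto_inner[OF tendsto_const q(3)]
            tendsto_mult[OF tendsto_add[OF tendsto_const inv] tendsto_inner[OF q(1,3)]]])
        (use px z in blast)
    then show "z \<bullet> u \<le> x \<bullet> u" by simp
    have "z \<bullet> v \<le> (1 + 0) * (y \<bullet> v)"
      by (rule LIMSEQ_le[OF tendsto_inner[OF tendsto_const q(4)]
            tendsto_mult[OF tendsto_add[OF tendsto_const inv] tendsto_inner[OF q(2,4)]]])
        (use px z in blast)
    then show "z \<bullet> u \<le> y \<bullet> u" using uv by simp
  qed
  have xy: "x \<in> X" "y \<in> X" and u: "norm u = 1" using l lxy by auto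
  have "x \<noteq> y" using dxy e by auto
  then have "midpoint x y \<in> interior X" using X xy unfolding strictly_convex_def by blast
  then obtain d where d: "d > 0" "cball (midpoint x y) d \<subseteq> X" by (meson mem_interior_cball)
  have "midpoint x y + d *\<^sub>R u \<in> X"
    using d u by (intro subsetD[OF d(2)]) (auto simp: dist_norm)
  then have "(midpoint x y + d *\<^sub>R u) \<bullet> u \<le> x \<bullet> u" by (rule mx)
  moreover have "x \<bullet> u = y \<bullet> u" using mx xy by (meson antisym)
  then have "(midpoint x y + d *\<^sub>R u) \<bullet> u = x \<bullet> u + d"
    using u by (simp add: midpoint_def inner_add_left dot_square_norm)
  ultimately show False using d by simp
qed

subsection \<open>Growing strictly convex bodies\<close>

text \<open>Only the larger set is required to be closed and convex; along a sequence of steps these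
  properties then hold for every set but the first.\<close>

definition small_step :: "real \<Rightarrow> ('a::real_normed_vector set \<times> 'a set) set" where
  "small_step e = {(A, B). A \<subseteq> B \<and> closed B \<and> convex B \<and> (\<forall>x\<in>B - A. \<forall>y\<in>B - A. dist x y \<le> e)}"

lemma small_step_mono: "e \<le> e' \<Longrightarrow> small_step e \<subseteq> small_step e'"
  by (force simp: small_step_def)

lemma small_step_scale:
  assumes "(A, B) \<in> small_step e" "m > 0"
  shows "((*\<^sub>R) m ` A, (*\<^sub>R) m ` B) \<in> small_step (m * e)"
proof -
  have "dist x y \<le> m * e" if "x \<in> (*\<^sub>R) m ` B - (*\<^sub>R) m ` A" "y \<in> (*\<^sub>R) m ` B - (*\<^sub>R) m ` A" for x y
  proof -
    obtain a b where ab: "a \<in> B - A" "b \<in> B - A" "x = m *\<^sub>R a" "y = m *\<^sub>R b"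
      using \<open>x \<in> _\<close> \<open>y \<in> _\<close> by blast
    then have "dist a b \<le> e" using assms(1) unfolding small_step_def by blast
    then show ?thesis using assms(2) ab by (simp add: dist_norm flip: scaleR_diff_right)
  qed
  then show ?thesis
    using assms by (auto simp: small_step_def intro!: closed_scaling convex_scaling)
qed

lemma small_step_translate:
  assumes "(A, B) \<in> small_step e"
  shows "((+) c ` A, (+) c ` B) \<in> small_step e"
proof -
  have "dist x y \<le> e" if "x \<in> (+) c ` B - (+) c ` A" "y \<in> (+) c ` B - (+) c ` A" for x y
  proof -
    obtain a b where "a \<in> B - A" "b \<in> B - A" "x = c + a" "y = c + b" using \<open>x \<in> _\<close> \<open>y \<in> _\<close> by blast
    then show ?thesis using assms by (simp add: small_step_def)
  qed
  then show ?thesis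
    using assms by (auto simp: small_step_def intro: closed_translation convex_translation)
qed

lemma rtrancl_image:
  assumes "(A, B) \<in> r\<^sup>*" "\<And>A B. (A, B) \<in> r \<Longrightarrow> (f A, f B) \<in> s"
  shows "(f A, f B) \<in> s\<^sup>*"
  using assms(1) by induction (auto intro: rtrancl_into_rtrancl assms(2))

text \<open>Starting from the dilate of \<open>X\<close> by \<open>l\<close>, the supporting half-spaces of \<open>X\<close> are imposed one small
  sector of normal directions at a time; each sector only removes a small cap.\<close>

lemma dilation_steps:
  fixes X :: "'a::euclidean_space set"
  assumes X: "compact X" "convex X" "strictly_convex X" "0 \<in> X" and e: "e > 0"
  shows "\<exists>l>1. (X, (*\<^sub>R) l ` X) \<in> (small_step e)\<^sup>*"
proof -
  obtain \<eta> where \<eta>: "\<eta> > 0" and caps: "\<And>x y u v. \<lbrakk>x \<in> X; y \<in> X; norm u = 1; norm v = 1; dist u v \<le> \<eta>;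
      \<forall>z\<in>X. z \<bullet> u \<le> (1 + \<eta>) * (x \<bullet> u); \<forall>z\<in>X. z \<bullet> v \<le> (1 + \<eta>) * (y \<bullet> v)\<rbrakk> \<Longrightarrow> dist x y \<le> e / 2"
    using small_caps[OF X(1,3), of "e / 2"] e by (metis half_gt_zero)
  \<comment> \<open>The bound \<open>l \<le> 1 + \<eta>\<close> puts the removed points into caps as
    in \<open>small_caps\<close>; the bound \<open>l \<le> 2\<close> turns the cap size
    \<open>e / 2\<close> into \<open>e\<close> after the dilation.\<close>
  define l where "l = 1 + min \<eta> 1"
  have l: "l > 1" "l \<le> 2" "l \<le> 1 + \<eta>" using \<eta> by (auto simp: l_def)
  define Y where "Y = (*\<^sub>R) l ` X"
  have Y: "closed Y" "convex Y" using X
    by (simp_all add: Y_def compact_scaling convex_scaling compact_imp_closed)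
  \<comment> \<open>One sector of normals: those within \<open>\<eta> / 2\<close> of
    \<open>p\<close>, so that two normals of the same sector differ by at most
    \<open>\<eta>\<close>.\<close>
  define H where "H p = {x. \<forall>u\<in>ball p (\<eta> / 2) \<inter> sphere 0 1. \<exists>z\<in>X. x \<bullet> u \<le> z \<bullet> u}" for p :: 'a
  have H: "closed (H p) \<and> convex (H p)" for p
  proof -
    have "closed {x. \<exists>z\<in>X. x \<bullet> u \<le> z \<bullet> u} \<and> convex {x. \<exists>z\<in>X. x \<bullet> u \<le> z \<bullet> u}" for u
    proof -
      have "continuous_on X (\<lambda>z. z \<bullet> u)" by (intro continuous_intros)
      then obtain z where "z \<in> X" "\<forall>y\<in>X. y \<bullet> u \<le> z \<bullet> u"
        using continuous_attains_sup[OF X(1)] X(4) by blast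
      then have "{x. \<exists>z\<in>X. x \<bullet> u \<le> z \<bullet> u} = {x. u \<bullet> x \<le> z \<bullet> u}"
        by (auto simp: inner_commute)
      then show ?thesis by (simp add: closed_halfspace_le convex_halfspace_le)
    qed
    moreover have "H p = (\<Inter>u\<in>ball p (\<eta> / 2) \<inter> sphere 0 1. {x. \<exists>z\<in>X. x \<bullet> u \<le> z \<bullet> u})"
      by (auto simp: H_def)
    ultimately show ?thesis by (simp add: closed_INT convex_INT)
  qed
  have step: "(Y \<inter> (\<Inter>p\<in>insert p J. H p), Y \<inter> (\<Inter>p\<in>J. H p)) \<in> small_step e" for p J
    unfolding small_step_def mem_Collect_eq prod.case
  proof (intro conjI ballI)
    show "Y \<inter> (\<Inter>p\<in>insert p J. H p) \<subseteq> Y \<inter> (\<Inter>p\<in>J. H p)" by blast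
    show "closed (Y \<inter> (\<Inter>p\<in>J. H p))" "convex (Y \<inter> (\<Inter>p\<in>J. H p))"
      using H Y by (auto intro!: closed_Int convex_Int closed_INT convex_INT)
    have *: "\<exists>a\<in>X. \<exists>u. x = l *\<^sub>R a \<and> norm u = 1 \<and> dist p u < \<eta> / 2 \<and> (\<forall>z\<in>X. z \<bullet> u \<le> (1 + \<eta>) * (a \<bullet> u))"
      if x: "x \<in> Y" "x \<notin> H p" for x
    proof -
      obtain a where a: "a \<in> X" "x = l *\<^sub>R a" using x by (auto simp: Y_def)
      obtain u where u: "norm u = 1" "dist p u < \<eta> / 2" "\<forall>z\<in>X. z \<bullet> u < x \<bullet> u"
        using x by (auto simp: H_def not_le)
      \<comment> \<open>Since \<open>X\<close> contains the origin, a point beyond a supporting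
        half-space has a positive inner product with the normal; this permits replacing the factor
        \<open>l\<close> by the larger \<open>1 + \<eta>\<close>.\<close>
      have "0 < l * (a \<bullet> u)" using u(3) X(4) a by force
      then have "a \<bullet> u \<ge> 0" using l by (simp add: zero_less_mult_iff)
      then have "l * (a \<bullet> u) \<le> (1 + \<eta>) * (a \<bullet> u)" using l by (intro mult_right_mono)
      then show ?thesis using a u by force
    qed
    show "dist x y \<le> e" if "x \<in> Y \<inter> (\<Inter>p\<in>J. H p) - Y \<inter> (\<Inter>p\<in>insert p J. H p)"
      "y \<in> Y \<inter> (\<Inter>p\<in>J. H p) - Y \<inter> (\<Inter>p\<in>insert p J. H p)" for x y
    proof -
      obtain a u where a: "a \<in> X" "x = l *\<^sub>R a" "norm u = 1" "dist p u < \<eta> / 2"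
        "\<forall>z\<in>X. z \<bullet> u \<le> (1 + \<eta>) * (a \<bullet> u)" using *[of x] \<open>x \<in> _\<close> by blast
      obtain b v where b: "b \<in> X" "y = l *\<^sub>R b" "norm v = 1" "dist p v < \<eta> / 2"
        "\<forall>z\<in>X. z \<bullet> v \<le> (1 + \<eta>) * (b \<bullet> v)" using *[of y] \<open>y \<in> _\<close> by blast
      have "dist u v \<le> \<eta>" using dist_triangle3[of u v p] a(4) b(4) by linarith
      then have "dist a b \<le> e / 2" using caps a b by blast
      then have "l * dist a b \<le> 2 * (e / 2)" using l by (intro mult_mono) auto
      then show ?thesis using a(2) b(2) l(1) by (simp add: dist_norm flip: scaleR_diff_right)
    qed
  qed
  have fin: "(Y \<inter> (\<Inter>p\<in>J. H p), Y) \<in> (small_step e)\<^sup>*" if "finite J" for J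
    using that
  proof (induction J)
    case (insert p J)
    show ?case using converse_rtrancl_into_rtrancl[OF step insert.IH] .
  qed auto
  obtain K where K: "finite K" "sphere (0::'a) 1 \<subseteq> (\<Union>p\<in>K. ball p (\<eta> / 2))"
    using compact_sphere[of "0::'a" 1] \<eta> unfolding compact_eq_totally_bounded by (meson half_gt_zero)
  have "Y \<inter> (\<Inter>p\<in>K. H p) = X"
  proof (intro equalityI subsetI)
    fix x assume x: "x \<in> X"
    have "(1 - 1/l) *\<^sub>R 0 + (1/l) *\<^sub>R x \<in> X"
      using x X l by (intro convexD) auto
    then have "l *\<^sub>R ((1/l) *\<^sub>R x) \<in> Y" unfolding Y_def by (intro imageI) simp
    then show "x \<in> Y \<inter> (\<Inter>p\<in>K. H p)" using x l by (auto simp: H_def)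
  next
    fix x assume x: "x \<in> Y \<inter> (\<Inter>p\<in>K. H p)"
    show "x \<in> X"
    proof (rule ccontr)
      assume "x \<notin> X"
      then obtain a b where ab: "a \<bullet> x < b" "\<forall>z\<in>X. b < a \<bullet> z"
        using separating_hyperplane_closed_point[OF X(2) compact_imp_closed[OF X(1)]] by blast
      have "a \<noteq> 0" using ab X(4) by force
      define u where "u = (- inverse (norm a)) *\<^sub>R a"
      have u: "norm u = 1" using \<open>a \<noteq> 0\<close> by (simp add: u_def)
      have zu: "z \<bullet> u < x \<bullet> u" if "z \<in> X" for z
      proof -
        have "a \<bullet> x < a \<bullet> z" using ab that by force
        then show ?thesis using \<open>a \<noteq> 0\<close> by (simp add: u_def inner_commute)
      qed
      obtain p where "p \<in> K" "u \<in> ball p (\<eta> / 2)" using K u by auto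
      then have "\<exists>z\<in>X. x \<bullet> u \<le> z \<bullet> u" using x u by (auto simp: H_def)
      then show False using zu by force
    qed
  qed
  then show ?thesis using fin[OF K(1)] l unfolding Y_def by metis
qed

text \<open>The dilation of the previous lemma is iterated. The \<open>n\<close>-th round is scaled
  by \<open>l ^ n\<close> and so are its increments; hence \<open>l\<close> is obtained for a size
  \<open>e'\<close> so small that the increments stay below \<open>e\<close> until the radius
  \<open>R\<close> is reached.\<close>

lemma ball_steps_centered:
  fixes X :: "'a::euclidean_space set"
  assumes X: "compact X" "convex X" "strictly_convex X" "0 \<in> interior X" and e: "e > 0" and R: "R > 0"
  shows "\<exists>Z. (X, Z) \<in> (small_step e)\<^sup>* \<and> cball 0 R \<subseteq> Z"
proof -
  obtain d where d: "d > 0" "cball 0 d \<subseteq> X" using X(4) mem_interior_cball by blast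
  define e' where "e' = e * d / R"
  have e': "e' > 0" using e d R by (simp add: e'_def)
  have "0 \<in> X" using X(4) interior_subset by blast
  then obtain l where l: "l > 1" "(X, (*\<^sub>R) l ` X) \<in> (small_step e')\<^sup>*"
    using dilation_steps[OF X(1-3) _ e'] by blast
  have iter: "(X, (*\<^sub>R) (l ^ n) ` X) \<in> (small_step e)\<^sup>*" if "\<forall>k<n. l ^ k * e' \<le> e" for n
    using that
  proof (induction n)
    case (Suc n)
    have "((*\<^sub>R) (l ^ n) ` X, (*\<^sub>R) (l ^ n) ` (*\<^sub>R) l ` X) \<in> (small_step e)\<^sup>*"
    proof (rule rtrancl_image[OF l(2)])
      fix A B :: "'a set" assume "(A, B) \<in> small_step e'"
      then have "((*\<^sub>R) (l ^ n) ` A, (*\<^sub>R) (l ^ n) ` B) \<in> small_step (l ^ n * e')"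
        using l by (intro small_step_scale) auto
      moreover have "l ^ n * e' \<le> e" using Suc.prems by blast
      ultimately show "((*\<^sub>R) (l ^ n) ` A, (*\<^sub>R) (l ^ n) ` B) \<in> small_step e"
        using small_step_mono by blast
    qed
    moreover have "(*\<^sub>R) (l ^ n) ` (*\<^sub>R) l ` X = (*\<^sub>R) (l ^ Suc n) ` X"
      by (simp add: image_image mult.commute)
    moreover have "(X, (*\<^sub>R) (l ^ n) ` X) \<in> (small_step e)\<^sup>*"
      using Suc.prems by (intro Suc.IH) simp
    ultimately show ?case by (metis rtrancl_trans)
  qed simp
  \<comment> \<open>Minimality bounds all earlier factors \<open>l ^ k\<close> by
    \<open>R / d\<close>, the very factor that takes \<open>e'\<close> to \<open>e\<close>.\<close>
  define n where "n = (LEAST n. R / d \<le> l ^ n)"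
  have "\<exists>n. R / d < l ^ n" using real_arch_pow[OF l(1)] by blast
  then have n: "R / d \<le> l ^ n" unfolding n_def by (metis LeastI_ex less_imp_le)
  have "l ^ k * e' \<le> e" if "k < n" for k
  proof -
    have "l ^ k < R / d" using not_less_Least[OF that[unfolded n_def]] by simp
    then have "l ^ k * e' \<le> R / d * e'" using e' by (intro mult_right_mono) auto
    also have "\<dots> = e" using d R by (simp add: e'_def)
    finally show ?thesis .
  qed
  then have "(X, (*\<^sub>R) (l ^ n) ` X) \<in> (small_step e)\<^sup>*" by (intro iter) blast
  moreover have "cball 0 R \<subseteq> (*\<^sub>R) (l ^ n) ` X"
  proof
    fix x :: 'a assume "x \<in> cball 0 R"
    then have "norm x \<le> d * l ^ n" using n d by (simp add: field_simps)
    then have "inverse (l ^ n) *\<^sub>R x \<in> X" using l by (intro subsetD[OF d(2)]) (simp add: field_simps)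
    moreover have "x = (l ^ n) *\<^sub>R (inverse (l ^ n) *\<^sub>R x)" using l by simp
    ultimately show "x \<in> (*\<^sub>R) (l ^ n) ` X" by blast
  qed
  ultimately show ?thesis by blast
qed

lemma strictly_convex_translation:
  assumes "strictly_convex S"
  shows "strictly_convex ((+) a ` S)"
proof -
  have "midpoint (a + x) (a + y) = a + midpoint x y" for x y
    by (simp add: midpoint_def scaleR_add_right flip: scaleR_add_left)
  then show ?thesis using assms by (auto simp: strictly_convex_def interior_translation)
qed

lemma ball_steps:
  fixes X :: "'a::euclidean_space set"
  assumes X: "compact X" "convex X" "strictly_convex X" "interior X \<noteq> {}" and e: "e > 0"
  shows "\<exists>Z. (X, Z) \<in> (small_step e)\<^sup>* \<and> cball 0 R \<subseteq> Z"
proof -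
  obtain c where c: "c \<in> interior X" using X by blast
  let ?X = "(+) (- c) ` X"
  have "strictly_convex ?X" using X(3) by (rule strictly_convex_translation)
  moreover have "0 \<in> interior ?X" using c unfolding interior_translation by force
  moreover have "compact ?X" using X(1) by (rule compact_translation)
  moreover have "convex ?X" using X(2) by (rule convex_translation)
  \<comment> \<open>The radius is enlarged by \<open>norm c\<close> to survive the translation back;
    the absolute value and the summand 1 make it positive for every \<open>R\<close>.\<close>
  ultimately obtain Z where Z: "(?X, Z) \<in> (small_step e)\<^sup>*" "cball 0 (\<bar>R\<bar> + norm c + 1) \<subseteq> Z"
    using ball_steps_centered[of ?X e "\<bar>R\<bar> + norm c + 1"] e
      abs_ge_zero[of R] norm_ge_zero[of c] by (meson add_nonneg_pos add_nonneg_nonneg zero_less_one)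
  have "((+) c ` ?X, (+) c ` Z) \<in> (small_step e)\<^sup>*"
    using Z(1) small_step_translate by (rule rtrancl_image)
  moreover have "(+) c ` ?X = X" by (auto simp: image_image)
  moreover have "cball 0 R \<subseteq> (+) c ` Z"
  proof
    fix x :: 'a assume "x \<in> cball 0 R"
    then have "x - c \<in> Z" using norm_triangle_ineq4[of x c] by (intro subsetD[OF Z(2)]) simp
    then show "x \<in> (+) c ` Z" by force
  qed
  ultimately show ?thesis by metis
qed

lemma exhausting_sequence:
  fixes X :: "'a::euclidean_space set"
  assumes X: "compact X" "convex X" "strictly_convex X" "interior X \<noteq> {}" and e: "e > 0"
  shows "\<exists>E M. E 0 = X \<and> (\<forall>i. (E i, E (Suc i)) \<in> small_step e) \<and> (\<forall>i. closed (E i) \<and> convex (E i))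
    \<and> (\<forall>i\<ge>M. cball 0 R \<subseteq> E i)"
proof -
  obtain Z where Z: "(X, Z) \<in> (small_step e)\<^sup>*" "cball 0 R \<subseteq> Z" using ball_steps[OF assms] by blast
  obtain n where "(X, Z) \<in> small_step e ^^ n" using rtrancl_imp_relpow[OF Z(1)] by blast
  then obtain f where f: "f 0 = X" "f n = Z" "\<And>i. i < n \<Longrightarrow> (f i, f (Suc i)) \<in> small_step e"
    unfolding relpow_fun_conv by blast
  have cc: "closed (f i) \<and> convex (f i)" if "i \<le> n" for i
  proof (cases i)
    case 0 then show ?thesis using X f by (simp add: compact_imp_closed)
  next
    case (Suc k) then show ?thesis using f(3)[of k] that by (auto simp: small_step_def)
  qed
  \<comment> \<open>The finite sequence is continued constantly, with empty increments from stage
    \<open>n\<close> on.\<close>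
  let ?E = "\<lambda>i. f (min i n)"
  have "(?E i, ?E (Suc i)) \<in> small_step e" for i
  proof (cases "i < n")
    case True then show ?thesis using f(3)[of i] by simp
  next
    case False then show ?thesis using cc[of n] by (auto simp: small_step_def)
  qed
  moreover have "cball 0 R \<subseteq> ?E i" if "i \<ge> n" for i using that Z f by simp
  moreover have "?E 0 = X" using f by simp
  ultimately show ?thesis using cc by (intro exI[of _ ?E] exI[of _ n]) auto
qed

subsection \<open>Convex chains\<close>

definition run :: "(nat \<Rightarrow> 'a set) \<Rightarrow> nat \<Rightarrow> nat \<Rightarrow> 'a set" where
  "run P i j = (\<Union>k\<in>{i..j}. P k)"

definition convex_chain :: "nat \<Rightarrow> (nat \<Rightarrow> 'a::real_vector set) \<Rightarrow> bool" where
  "convex_chain N P \<longleftrightarrow> (\<forall>i j. i \<le> j \<and> j < N \<longrightarrow> convex (run P i j))"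

lemma convex_chainD: "convex_chain N P \<Longrightarrow> i \<le> j \<Longrightarrow> j < N \<Longrightarrow> convex (run P i j)"
  by (auto simp: convex_chain_def)

lemma run_mono: "i' \<le> i \<Longrightarrow> j \<le> j' \<Longrightarrow> run P i j \<subseteq> run P i' j'"
  by (fastforce simp: run_def)

lemma run_single [simp]: "run P i i = P i"
  by (simp add: run_def)

lemma run_empty: "j < i \<Longrightarrow> run P i j = {}"
  by (simp add: run_def)

lemma run_Suc_right: "i \<le> Suc j \<Longrightarrow> run P i (Suc j) = run P i j \<union> P (Suc j)"
  by (auto simp: run_def atLeastAtMostSuc_conv)

lemma run_last: "i < j \<Longrightarrow> run P i j = run P i (j - 1) \<union> P j"
  using run_Suc_right[of i "j - 1" P] by simp

lemma run_first: "i \<le> j \<Longrightarrow> run P i j = P i \<union> run P (Suc i) j"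
  unfolding run_def by (simp add: atLeastAtMost_insertL[symmetric])

lemma run_rev:
  assumes "a \<le> b" "b < N"
  shows "run (\<lambda>k. P (N - 1 - k)) a b = run P (N - 1 - b) (N - 1 - a)"
proof -
  have "(\<lambda>k. N - 1 - k) ` {a..b} = {N - 1 - b..N - 1 - a}"
  proof (intro equalityI subsetI)
    fix x assume "x \<in> {N - 1 - b..N - 1 - a}"
    then show "x \<in> (\<lambda>k. N - 1 - k) ` {a..b}"
      using assms by (intro image_eqI[of _ _ "N - 1 - x"]) auto
  qed auto
  then show ?thesis unfolding run_def by (metis image_image)
qed

lemma convex_chain_rev:
  assumes "convex_chain N P"
  shows "convex_chain N (\<lambda>k. P (N - 1 - k))"
  unfolding convex_chain_def
proof (intro allI impI)
  fix i j assume ij: "i \<le> j \<and> j < N"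
  then show "convex (run (\<lambda>k. P (N - 1 - k)) i j)"
    using convex_chainD[OF assms, of "N - 1 - j" "N - 1 - i"] by (subst run_rev) auto
qed

text \<open>The growing bodies are indexed by the set that grows and not by the end points of a run.
  The reversed chain has the same runs, so one family \<open>E\<close> serves both directions, and
  rising and falling stages that come from one run are nested in each other.\<close>

definition expansions :: "nat \<Rightarrow> (nat \<Rightarrow> 'a::real_vector set) \<Rightarrow> ('a set \<Rightarrow> nat \<Rightarrow> 'a set) \<Rightarrow> bool" where
  "expansions N P E \<longleftrightarrow> (\<forall>i j. i \<le> j \<and> j < N \<longrightarrow> E (run P i j) 0 = run P i j
    \<and> (\<forall>m. E (run P i j) m \<subseteq> E (run P i j) (Suc m) \<and> convex (E (run P i j) m)))"

lemma expansionsD: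
  assumes "expansions N P E" "i \<le> j \<and> j < N"
  shows "E (run P i j) 0 = run P i j \<and> (\<forall>m. E (run P i j) m \<subseteq> E (run P i j) (Suc m) \<and> convex (E (run P i j) m))"
  using assms by (simp add: expansions_def)

lemma expansions_rev:
  assumes "expansions N P E"
  shows "expansions N (\<lambda>k. P (N - 1 - k)) E"
  unfolding expansions_def
proof (intro allI impI)
  fix i j assume ij: "i \<le> j \<and> j < N"
  have run_ij: "run (\<lambda>k. P (N - 1 - k)) i j = run P (N - 1 - j) (N - 1 - i)" using ij by (simp only: run_rev)
  have "N - 1 - j \<le> N - 1 - i \<and> N - 1 - i < N" using ij by auto
  then show "E (run (\<lambda>k. P (N - 1 - k)) i j) 0 = run (\<lambda>k. P (N - 1 - k)) i j
    \<and> (\<forall>m. E (run (\<lambda>k. P (N - 1 - k)) i j) m \<subseteq> E (run (\<lambda>k. P (N - 1 - k)) i j) (Suc m)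
        \<and> convex (E (run (\<lambda>k. P (N - 1 - k)) i j) m))"
    unfolding run_ij by (rule expansionsD[OF assms])
qed

lemma expansions_convex:
  "expansions N P E \<Longrightarrow> i \<le> j \<Longrightarrow> j < N \<Longrightarrow> convex (E (run P i j) m)"
  using expansionsD by blast

lemma expansions_mono:
  assumes "expansions N P E" "i \<le> j" "j < N" "m \<le> m'"
  shows "E (run P i j) m \<subseteq> E (run P i j) m'"
proof (rule lift_Suc_mono_le[OF _ assms(4)])
  show "E (run P i j) n \<subseteq> E (run P i j) (Suc n)" for n
    using expansionsD[OF assms(1), of i j] assms(2,3) by blast
qed

lemma expansions_superset:
  assumes "expansions N P E" "i \<le> j" "j < N"
  shows "run P i j \<subseteq> E (run P i j) m"
  using expansions_mono[OF assms, of 0 m] expansionsD[OF assms(1), of i j] assms(2,3) by simp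

lemma run_subset_expansion:
  assumes "expansions N P E" "a \<le> i" "j \<le> b" "a \<le> b" "b < N"
  shows "run P i j \<subseteq> E (run P a b) m"
  using run_mono[OF assms(2,3), of P] expansions_superset[OF assms(1,4,5), of m] by blast

text \<open>The stages through which \<open>P j\<close> grows out of \<open>P (j - 1) \<inter> P j\<close>: intersecting with expansions of a
  run keeps the union with every earlier run convex.\<close>

definition rising_sets :: "('a set \<Rightarrow> nat \<Rightarrow> 'a set) \<Rightarrow> (nat \<Rightarrow> 'a set) \<Rightarrow> nat \<Rightarrow> 'a set set" where
  "rising_sets E P j = insert (P j)
    {P j \<inter> (if a = 0 then UNIV else run P (a - 1) (j - 1)) \<inter> E (run P a (j - 1)) m | a m. a < j}"

text \<open>The mirror image of \<open>rising_sets\<close>. At the end of the chain there is no run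
  with one more member to intersect with, hence \<open>UNIV\<close>.\<close>

definition falling_sets :: "('a set \<Rightarrow> nat \<Rightarrow> 'a set) \<Rightarrow> nat \<Rightarrow> (nat \<Rightarrow> 'a set) \<Rightarrow> nat \<Rightarrow> 'a set set" where
  "falling_sets E N P i = insert (P i)
    {P i \<inter> (if Suc b = N then UNIV else run P (Suc i) (Suc b)) \<inter> E (run P (Suc i) b) m | b m. i < b \<and> b < N}"

text \<open>The index \<open>a\<close> in the reversed chain corresponds to
  \<open>b = N - 1 - a\<close>. This transfers results on rising stages to falling ones.\<close>

lemma falling_sets_rev:
  assumes "i < N"
  shows "rising_sets E (\<lambda>k. P (N - 1 - k)) (N - 1 - i) = falling_sets E N P i"
proof -
  have 1: "run (\<lambda>k. P (N - 1 - k)) a (N - 1 - i - 1) = run P (Suc i) (N - 1 - a)" if "a < N - 1 - i" for a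
    using that run_rev[of a "N - 1 - i - 1" N P] by simp
  have 2: "run (\<lambda>k. P (N - 1 - k)) (a - 1) (N - 1 - i - 1) = run P (Suc i) (Suc (N - 1 - a))"
    if "a < N - 1 - i" "a \<noteq> 0" for a
  proof -
    have "N - 1 - (N - 1 - i - 1) = Suc i" "N - 1 - (a - 1) = Suc (N - 1 - a)" using that by auto
    then show ?thesis using that run_rev[of "a - 1" "N - 1 - i - 1" N P] by simp
  qed
  have "{P i \<inter> (if a = 0 then UNIV else run P (Suc i) (Suc (N - 1 - a))) \<inter> E (run P (Suc i) (N - 1 - a)) m
        | a m. a < N - 1 - i}
    = {P i \<inter> (if Suc b = N then UNIV else run P (Suc i) (Suc b)) \<inter> E (run P (Suc i) b) m | b m. i < b \<and> b < N}"
    (is "?L = ?R")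
  proof (intro equalityI subsetI)
    fix x assume "x \<in> ?L"
    then obtain a m where "a < N - 1 - i"
      "x = P i \<inter> (if a = 0 then UNIV else run P (Suc i) (Suc (N - 1 - a))) \<inter> E (run P (Suc i) (N - 1 - a)) m"
      by blast
    then show "x \<in> ?R" using assms by (intro CollectI exI[of _ "N - 1 - a"] exI[of _ m]) auto
  next
    fix x assume "x \<in> ?R"
    then obtain b m where "i < b" "b < N"
      "x = P i \<inter> (if Suc b = N then UNIV else run P (Suc i) (Suc b)) \<inter> E (run P (Suc i) b) m"
      by blast
    then show "x \<in> ?L" using assms by (intro CollectI exI[of _ "N - 1 - b"] exI[of _ m]) auto
  qed
  moreover have "rising_sets E (\<lambda>k. P (N - 1 - k)) (N - 1 - i) = insert (P i)
    {P i \<inter> (if a = 0 then UNIV else run P (Suc i) (Suc (N - 1 - a))) \<inter> E (run P (Suc i) (N - 1 - a)) m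
        | a m. a < N - 1 - i}"
  proof -
    have "N - 1 - (N - 1 - i) = i" using assms by simp
    then show ?thesis unfolding rising_sets_def using 1 2
      by (intro arg_cong2[of _ _ _ _ insert] Collect_cong ex_cong1) (auto cong: conj_cong)
  qed
  ultimately show ?thesis unfolding falling_sets_def by simp
qed

lemma rising_subset: "A \<in> rising_sets E P j \<Longrightarrow> A \<subseteq> P j"
  by (auto simp: rising_sets_def)

lemma falling_subset: "A \<in> falling_sets E N P i \<Longrightarrow> A \<subseteq> P i"
  by (auto simp: falling_sets_def)

text \<open>If \<open>a \<le> i\<close>, the run from \<open>i\<close> to \<open>j - 1\<close> lies
  in both sets with which \<open>P j\<close> is intersected, so the union is a convex run cut by two
  convex sets. If \<open>a > i\<close>, the factor \<open>run P (a - 1) (j - 1)\<close> places the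
  stage inside the run. This dichotomy is the purpose of that factor.\<close>

lemma convex_run_rising:
  assumes ch: "convex_chain N P" and E: "expansions N P E" and ij: "i < j" "j < N"
    and A: "A \<in> rising_sets E P j"
  shows "convex (run P i (j - 1) \<union> A)"
proof -
  consider "A = P j" | a m where "a < j"
    "A = P j \<inter> (if a = 0 then UNIV else run P (a - 1) (j - 1)) \<inter> E (run P a (j - 1)) m"
    using A by (auto simp: rising_sets_def)
  then show ?thesis
  proof cases
    case 1 then show ?thesis using convex_chainD[OF ch, of i j] ij run_last[OF ij(1), of P] by simp
  next
    case 2
    let ?Q = "if a = 0 then UNIV else run P (a - 1) (j - 1)"
    show ?thesis
    proof (cases "a \<le> i")
      case True
      have "run P i (j - 1) \<subseteq> E (run P a (j - 1)) m"
        using True 2 ij by (intro run_subset_expansion[OF E]) auto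
      moreover have "run P i (j - 1) \<subseteq> ?Q" using run_mono[of "a - 1" i "j - 1" "j - 1" P] True by auto
      ultimately have "run P i (j - 1) \<union> A = run P i j \<inter> ?Q \<inter> E (run P a (j - 1)) m"
        using 2 run_last[OF ij(1), of P] by auto
      moreover have "convex ?Q" using convex_chainD[OF ch, of "a - 1" "j - 1"] ij 2 by auto
      moreover have "convex (E (run P a (j - 1)) m)" using expansions_convex[OF E, of a "j - 1" m] 2 ij by simp
      ultimately show ?thesis using convex_chainD[OF ch, of i j] ij by (simp add: convex_Int)
    next
      case False
      then have "run P (a - 1) (j - 1) \<subseteq> run P i (j - 1)" by (intro run_mono) auto
      then have "A \<subseteq> run P i (j - 1)" using 2 False by auto
      then have "run P i (j - 1) \<union> A = run P i (j - 1)" by blast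
      then show ?thesis using convex_chainD[OF ch, of i "j - 1"] ij by simp
    qed
  qed
qed

lemma convex_rising:
  assumes ch: "convex_chain N P" and E: "expansions N P E" and j: "j < N" and A: "A \<in> rising_sets E P j"
  shows "convex A"
proof -
  have "convex (P j)" using convex_chainD[OF ch, of j j] j by simp
  moreover have "convex (run P (a - 1) (j - 1))" "convex (E (run P a (j - 1)) m)" if "a < j" for a m
    using convex_chainD[OF ch, of "a - 1" "j - 1"] expansions_convex[OF E, of a "j - 1" m] that j by auto
  ultimately show ?thesis using A by (auto simp: rising_sets_def intro!: convex_Int)
qed

lemma convex_falling_run:
  assumes ch: "convex_chain N P" and E: "expansions N P E" and ij: "i < j" "j < N"
    and A: "A \<in> falling_sets E N P i"
  shows "convex (A \<union> run P (Suc i) j)"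
proof -
  have "convex (run (\<lambda>k. P (N - 1 - k)) (N - 1 - j) (N - 1 - i - 1) \<union> A)"
    using ij A by (intro convex_run_rising[OF convex_chain_rev[OF ch] expansions_rev[OF E]])
      (auto simp only: falling_sets_rev)
  moreover have "run (\<lambda>k. P (N - 1 - k)) (N - 1 - j) (N - 1 - i - 1) = run P (Suc i) j"
    using ij by (subst run_rev) auto
  ultimately show ?thesis by (simp add: Un_commute)
qed

text \<open>A partial end member that comes from a run longer than the middle run is handled by
  intersecting as in the one-sided case; one that comes from a shorter run is contained in the
  middle run. There remains the case in which both ends grow out of exactly the middle run: they are
  then stages of one increasing family, and the end with the earlier stage is absorbed by the
  rest.\<close>

lemma convex_falling_run_rising:
  assumes ch: "convex_chain N P" and E: "expansions N P E" and ij: "i < j" "j < N"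
    and A: "A \<in> rising_sets E P j" and B: "B \<in> falling_sets E N P i"
  shows "convex (B \<union> run P (Suc i) (j - 1) \<union> A)"
proof -
  let ?R = "run P (Suc i) (j - 1)"
  have Bi: "B \<subseteq> P i" using B by (rule falling_subset)
  have Aj: "A \<subseteq> P j" using A by (rule rising_subset)
  have iR: "run P i (j - 1) = P i \<union> ?R" using run_first[of i "j - 1" P] ij by simp
  have Rj: "run P (Suc i) j = ?R \<union> P j"
    using run_last[of "Suc i" j P] ij by (cases "Suc i = j") (auto simp: run_empty)
  have BRj: "convex (B \<union> run P (Suc i) j)" using convex_falling_run[OF ch E ij B] .
  have iRA: "convex (run P i (j - 1) \<union> A)" using convex_run_rising[OF ch E ij A] .
  consider (A1) "A = P j" | (B1) "B = P i"
    | (AB) a m b n where "a < j"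
    "A = P j \<inter> (if a = 0 then UNIV else run P (a - 1) (j - 1)) \<inter> E (run P a (j - 1)) m"
    "i < b" "b < N"
    "B = P i \<inter> (if Suc b = N then UNIV else run P (Suc i) (Suc b)) \<inter> E (run P (Suc i) b) n"
    using A B by (auto simp: rising_sets_def falling_sets_def)
  then show ?thesis
  proof cases
    case A1 then show ?thesis using BRj Rj by (simp add: Un_assoc)
  next
    case B1 then show ?thesis using iRA iR by simp
  next
    case AB
    define Q where "Q = (if a = 0 then UNIV else run P (a - 1) (j - 1))"
    define S where "S = (if Suc b = N then UNIV else run P (Suc i) (Suc b))"
    define EA where "EA = E (run P a (j - 1)) m"
    define EB where "EB = E (run P (Suc i) b) n"
    have A': "A = P j \<inter> Q \<inter> EA" and B': "B = P i \<inter> S \<inter> EB"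
      using AB by (simp_all only: Q_def S_def EA_def EB_def)
    have Q: "convex Q" using convex_chainD[OF ch, of "a - 1" "j - 1"] ij AB by (auto simp: Q_def)
    have S: "convex S" using convex_chainD[OF ch, of "Suc i" "Suc b"] ij AB by (auto simp: S_def)
    have cE: "convex EA" "convex EB"
      using expansions_convex[OF E, of a "j - 1" m] expansions_convex[OF E, of "Suc i" b n] AB(1,3,4) ij
      by (auto simp: EA_def EB_def)
    consider "a \<le> i" | "b \<ge> j" | "a > Suc i" | "b < j - 1" | "a = Suc i" "b = j - 1"
      by linarith
    then show ?thesis
    proof cases
      case 1
      have "run P i (j - 1) \<subseteq> EA"
        unfolding EA_def using 1 AB(1) ij by (intro run_subset_expansion[OF E]) auto
      moreover have "run P i (j - 1) \<subseteq> Q" using run_mono[of "a - 1" i "j - 1" "j - 1" P] 1 by (auto simp: Q_def)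
      ultimately have "B \<union> ?R \<union> A = (B \<union> run P (Suc i) j) \<inter> Q \<inter> EA"
        unfolding A' Rj using iR Bi by blast
      then show ?thesis using BRj Q cE by (simp add: convex_Int)
    next
      case 2
      have "run P (Suc i) j \<subseteq> EB"
        unfolding EB_def using 2 AB(3,4) by (intro run_subset_expansion[OF E]) auto
      moreover have "run P (Suc i) j \<subseteq> S"
        using run_mono[of "Suc i" "Suc i" j "Suc b" P] 2 by (auto simp: S_def)
      ultimately have "B \<union> ?R \<union> A = (run P i (j - 1) \<union> A) \<inter> S \<inter> EB"
        unfolding B' iR using Rj Aj by blast
      then show ?thesis using iRA S cE by (simp add: convex_Int)
    next
      case 3
      then have "run P (a - 1) (j - 1) \<subseteq> ?R" by (intro run_mono) auto
      then have "A \<subseteq> ?R" using A' 3 by (auto simp: Q_def)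
      then have "B \<union> ?R \<union> A = B \<union> run P (Suc i) (j - 1)" by blast
      then show ?thesis using convex_falling_run[OF ch E _ _ B, of "j - 1"] 3 AB(1) ij by simp
    next
      case 4
      then have "run P (Suc i) (Suc b) \<subseteq> ?R" by (intro run_mono) auto
      then have "B \<subseteq> ?R" using B' 4 ij by (auto simp: S_def)
      then have "B \<union> ?R \<union> A = run P (Suc i) (j - 1) \<union> A" by blast
      then show ?thesis using convex_run_rising[OF ch E _ _ A, of "Suc i"] 4 AB(3) ij by simp
    next
      case 5
      \<comment> \<open>A point of \<open>A\<close> outside the middle run lies in
        \<open>P i \<inter> P j\<close>, and therefore in \<open>B\<close> if
        \<open>m \<le> n\<close>. For \<open>m > n\<close> the roles are exchanged.\<close>
      have Aeq: "A = P j \<inter> run P i (j - 1) \<inter> E ?R m" using A' 5 by (simp add: Q_def EA_def)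
      have Beq: "B = P i \<inter> run P (Suc i) j \<inter> E ?R n" using B' 5 AB(1) ij by (auto simp: S_def EB_def)
      show ?thesis
      proof (cases "m \<le> n")
        case True
        then have "E ?R m \<subseteq> E ?R n" using expansions_mono[OF E, of "Suc i" "j - 1"] 5 AB(1) ij by simp
        then have "B \<union> ?R \<union> A = B \<union> run P (Suc i) (j - 1)" using Aeq Beq iR Rj by blast
        then show ?thesis using convex_falling_run[OF ch E _ _ B, of "j - 1"] 5 AB(1) ij by simp
      next
        case False
        then have "E ?R n \<subseteq> E ?R m" using expansions_mono[OF E, of "Suc i" "j - 1"] 5 AB(1) ij by simp
        then have "B \<union> ?R \<union> A = run P (Suc i) (j - 1) \<union> A" using Aeq Beq iR Rj by blast
        then show ?thesis using convex_run_rising[OF ch E _ _ A, of "Suc i"] 5 AB(1) ij by simp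
      qed
    qed
  qed
qed

subsection \<open>Slow chains\<close>

text \<open>Each member becomes a block of \<open>L\<close> cells that rises to \<open>P j\<close>
  at offset \<open>V\<close> and falls from \<open>P j\<close> at offset \<open>V + 1\<close>. A run
  within one block equals its largest cell. A run across blocks consists of a falling stage, full
  members and a rising stage, which is the situation of \<open>cross\<close>.\<close>

lemma convex_chain_ramps:
  fixes U D :: "nat \<Rightarrow> nat \<Rightarrow> 'a::real_vector set"
  assumes U_mono: "\<And>j v w. j < N \<Longrightarrow> v \<le> w \<Longrightarrow> w \<le> V \<Longrightarrow> U j v \<subseteq> U j w"
    and D_mono: "\<And>j v w. j < N \<Longrightarrow> v \<le> w \<Longrightarrow> w \<le> V \<Longrightarrow> D j v \<subseteq> D j w"
    and top: "\<And>j. j < N \<Longrightarrow> U j V = P j" "\<And>j. j < N \<Longrightarrow> D j V = P j"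
    and cvx: "\<And>j v. j < N \<Longrightarrow> v \<le> V \<Longrightarrow> convex (U j v)" "\<And>j v. j < N \<Longrightarrow> v \<le> V \<Longrightarrow> convex (D j v)"
    and cross: "\<And>i j v w. i < j \<Longrightarrow> j < N \<Longrightarrow> v \<le> V \<Longrightarrow> w \<le> V \<Longrightarrow>
        convex (D i v \<union> run P (Suc i) (j - 1) \<union> U j w)"
    and L: "L = 2 * Suc V"
    and C: "\<And>q. C q = (if q mod L \<le> V then U (q div L) (q mod L) else D (q div L) (L - 1 - q mod L))"
  shows "convex_chain (N * L) C"
  unfolding convex_chain_def
proof (intro allI impI)
  fix s t assume "s \<le> t \<and> t < N * L"
  then have st: "s \<le> t" "t < N * L" by auto
  have L0: "L > 0" using L by simp
  define i j where "i = s div L" and "j = t div L"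
  have ij: "i \<le> j" "j < N" using st L0
    by (auto simp: i_def j_def div_le_mono less_mult_imp_div_less)
  have mL: "q mod L < L" for q using L0 by simp
  have CP: "C q \<subseteq> P (q div L)" if "q div L < N" for q
    using U_mono[OF that, of "q mod L" V] D_mono[OF that, of "L - 1 - q mod L" V] top[OF that] mL[of q] L
    by (auto simp: C)
  have kV: "(k * L + V) div L = k" "(k * L + V) mod L = V" for k
  proof -
    have "V < L" using L by simp
    then show "(k * L + V) div L = k" "(k * L + V) mod L = V" by simp_all
  qed
  have CV: "C (k * L + V) = P k" if "k < N" for k
    using top[OF that] kV by (simp add: C)
  have le_cases: "q \<le> q' \<longleftrightarrow> q div L < q' div L \<or> q div L = q' div L \<and> q mod L \<le> q' mod L" for q q'
  proof -
    have "q \<le> q' \<Longrightarrow> q div L \<le> q' div L" by (rule div_le_mono)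
    moreover have "q div L < q' div L \<Longrightarrow> q \<le> q'" by (meson div_le_mono linorder_not_le nat_le_linear)
    moreover have "q div L = q' div L \<Longrightarrow> q \<le> q' \<longleftrightarrow> q mod L \<le> q' mod L"
      by (metis add_le_cancel_left div_mult_mod_eq)
    ultimately show ?thesis by (metis le_neq_implies_less)
  qed
  \<comment> \<open>The contributions \<open>B\<close> and \<open>A\<close> of the first and the
    last block to a run across blocks: the full member if the run passes its peak, otherwise the
    cell at the end of the run.\<close>
  define B where "B = (if s mod L \<le> V then P i else C s)"
  define A where "A = (if t mod L \<le> V then C t else P j)"
  have B: "C q \<subseteq> B" if "s \<le> q" "q div L = i" for q
  proof (cases "s mod L \<le> V")
    case True then show ?thesis using CP[of q] that ij by (simp add: B_def)
  next
    case False
    then have "\<not> q mod L \<le> V" "L - 1 - q mod L \<le> L - 1 - s mod L" "L - 1 - s mod L \<le> V"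
      using that le_cases[of s q] L by (auto simp: i_def)
    then show ?thesis using False that D_mono[of i "L - 1 - q mod L" "L - 1 - s mod L"] ij
      by (simp add: B_def C i_def)
  qed
  have A: "C q \<subseteq> A" if "q \<le> t" "q div L = j" for q
  proof (cases "t mod L \<le> V")
    case False then show ?thesis using CP[of q] that ij by (simp add: A_def)
  next
    case True
    then have "q mod L \<le> t mod L" using that le_cases[of q t] by (auto simp: j_def)
    then show ?thesis using True that U_mono[of j "q mod L" "t mod L"] ij
      by (simp add: A_def C j_def)
  qed
  have Bform: "\<exists>v\<le>V. B = D i v"
  proof (cases "s mod L \<le> V")
    case True then show ?thesis using top ij by (auto simp: B_def)
  next
    case False
    then have "L - 1 - s mod L \<le> V" using L by auto
    then show ?thesis using False by (auto simp: B_def C i_def)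
  qed
  have Aform: "\<exists>v\<le>V. A = U j v"
    using top(1)[of j] ij by (auto simp: A_def C j_def)
  show "convex (run C s t)"
  proof (cases "i = j")
    case True
    consider "t mod L \<le> V" | "V < s mod L" | "s mod L \<le> V" "V < t mod L" by linarith
    then have "run C s t = A \<or> run C s t = B"
    proof cases
      case 1
      then have "A = C t" by (simp add: A_def)
      moreover have "C q \<subseteq> A" if "q \<in> {s..t}" for q
        using A[of q] that True le_cases[of s q] le_cases[of q t] by (auto simp: i_def j_def)
      ultimately have "run C s t = A" using st by (fastforce simp: run_def)
      then show ?thesis ..
    next
      case 2
      then have "B = C s" by (simp add: B_def)
      moreover have "C q \<subseteq> B" if "q \<in> {s..t}" for q
        using B[of q] that True le_cases[of s q] le_cases[of q t] by (auto simp: i_def j_def)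
      ultimately have "run C s t = B" using st by (fastforce simp: run_def)
      then show ?thesis ..
    next
      case 3
      then have "B = P i" by (simp add: B_def)
      moreover have "C q \<subseteq> B" if "q \<in> {s..t}" for q
        using B[of q] that True le_cases[of s q] le_cases[of q t] by (auto simp: i_def j_def)
      moreover have "C (i * L + V) = P i" using CV ij by simp
      moreover have "i * L + V \<in> {s..t}"
        using 3 True le_cases[of s "i * L + V"] le_cases[of "i * L + V" t] unfolding kV
        by (auto simp: i_def j_def)
      ultimately have "run C s t = B" by (fastforce simp: run_def)
      then show ?thesis ..
    qed
    then show ?thesis using Aform Bform cvx ij by auto
  next
    case False
    then have "i < j" using ij by simp
    have "run C s t = B \<union> run P (Suc i) (j - 1) \<union> A"
    proof (intro equalityI subsetI)
      fix x assume "x \<in> run C s t"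
      then obtain q where q: "s \<le> q" "q \<le> t" "x \<in> C q" by (auto simp: run_def)
      have "i \<le> q div L" "q div L \<le> j" using q by (auto simp: i_def j_def div_le_mono)
      then consider "q div L = i" | "q div L = j" | "q div L \<in> {Suc i..j - 1}" by fastforce
      then show "x \<in> B \<union> run P (Suc i) (j - 1) \<union> A"
      proof cases
        case 1 then show ?thesis using B q by blast
      next
        case 2 then show ?thesis using A q by blast
      next
        case 3 then show ?thesis using CP[of q] q ij \<open>q div L \<le> j\<close> by (auto simp: run_def)
      qed
    next
      fix x assume "x \<in> B \<union> run P (Suc i) (j - 1) \<union> A"
      then consider "x \<in> B" | k where "k \<in> {Suc i..j - 1}" "x \<in> P k" | "x \<in> A" by (auto simp: run_def)
      then show "x \<in> run C s t"
      proof cases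
        case 1
        have "\<exists>q\<in>{s..t}. B = C q"
        proof (cases "s mod L \<le> V")
          case True
          have "s \<le> i * L + V" "i * L + V \<le> t"
            using True \<open>i < j\<close> le_cases[of s "i * L + V"] le_cases[of "i * L + V" t] unfolding kV
            by (auto simp: i_def j_def)
          then show ?thesis using True CV[of i] ij by (intro bexI[of _ "i * L + V"]) (auto simp: B_def)
        qed (use st in \<open>auto simp: B_def\<close>)
        then show ?thesis using 1 by (auto simp: run_def)
      next
        case 2
        have "s \<le> k * L + V" "k * L + V \<le> t"
          using 2 \<open>i < j\<close> le_cases[of s "k * L + V"] le_cases[of "k * L + V" t] unfolding kV
          by (auto simp: i_def j_def)
        moreover have "x \<in> C (k * L + V)" using 2 CV[of k] ij by auto
        ultimately show ?thesis by (auto simp: run_def)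
      next
        case 3
        have "\<exists>q\<in>{s..t}. A = C q"
        proof (cases "t mod L \<le> V")
          case False
          have "s \<le> j * L + V" "j * L + V \<le> t"
            using False \<open>i < j\<close> le_cases[of s "j * L + V"] le_cases[of "j * L + V" t] unfolding kV
            by (auto simp: i_def j_def)
          then show ?thesis using False CV[of j] ij by (intro bexI[of _ "j * L + V"]) (auto simp: A_def)
        qed (use st in \<open>auto simp: A_def\<close>)
        then show ?thesis using 3 by (auto simp: run_def)
      qed
    qed
    then show ?thesis using cross[OF \<open>i < j\<close> ij(2)] Aform Bform by auto
  qed
qed

text \<open>The stage number is read in base \<open>M + 1\<close>: the quotient \<open>h\<close>
  selects the run from \<open>a = j - 1 - h\<close> to \<open>j - 1\<close>, the remainder the stage
  of its expansion, so the runs get longer as \<open>v\<close> grows. The condition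
  \<open>Suc h = j\<close> singles out \<open>a = 0\<close>; otherwise \<open>j - 2 - h\<close> is
  \<open>a - 1\<close>.\<close>

definition rise ::
  "('a set \<Rightarrow> nat \<Rightarrow> 'a set) \<Rightarrow> nat \<Rightarrow> (nat \<Rightarrow> 'a set) \<Rightarrow> nat \<Rightarrow> nat \<Rightarrow> 'a set" where
  "rise E M P j v = (if v div Suc M < j
    then P j \<inter> (if Suc (v div Suc M) = j then UNIV else run P (j - 2 - v div Suc M) (j - 1))
      \<inter> E (run P (j - 1 - v div Suc M) (j - 1)) (v mod Suc M)
    else P j)"

lemma rise_in_rising_sets: "rise E M P j v \<in> rising_sets E P j"
proof (cases "v div Suc M < j")
  case True
  let ?a = "j - 1 - v div Suc M"
  have "?a < j" "?a = 0 \<longleftrightarrow> Suc (v div Suc M) = j" "?a - 1 = j - 2 - v div Suc M" using True by auto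
  then have "rise E M P j v = P j \<inter> (if ?a = 0 then UNIV else run P (?a - 1) (j - 1)) \<inter> E (run P ?a (j - 1)) (v mod Suc M)"
    using True by (simp only: rise_def if_True)
  then show ?thesis using \<open>?a < j\<close> unfolding rising_sets_def by blast
qed (simp add: rise_def rising_sets_def)

lemma rise_top: "Suc M * j \<le> v \<Longrightarrow> rise E M P j v = P j"
  using div_le_mono[of "Suc M * j" v "Suc M"] by (auto simp: rise_def simp del: mult_Suc)

lemma rise_0:
  assumes "expansions N P E" "0 < j" "j < N"
  shows "rise E M P j 0 = P (j - 1) \<inter> P j"
proof -
  have "E (P (j - 1)) 0 = P (j - 1)" using expansionsD[OF assms(1), of "j - 1" "j - 1"] assms(3) by simp
  moreover have "P (j - 1) \<subseteq> run P (j - 2) (j - 1)" using run_mono[of "j - 2" "j - 1" "j - 1" "j - 1" P] by simp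
  ultimately show ?thesis using assms(2) by (auto simp: rise_def)
qed

lemma rise_step:
  assumes E: "expansions N P E" and j: "j < N"
    and full: "\<And>a. a < j \<Longrightarrow> P j \<subseteq> E (run P a (j - 1)) M"
  shows "rise E M P j (Suc v) = rise E M P j v
    \<or> (\<exists>a<j. \<exists>m. rise E M P j v \<subseteq> rise E M P j (Suc v)
        \<and> rise E M P j (Suc v) - rise E M P j v \<subseteq> E (run P a (j - 1)) (Suc m) - E (run P a (j - 1)) m)"
proof -
  let ?h = "v div Suc M" and ?m = "v mod Suc M"
  show ?thesis
  proof (cases "?h < j")
    case False
    have "v div Suc M \<le> Suc v div Suc M" by (intro div_le_mono) simp
    then have "\<not> Suc v div Suc M < j" using False by linarith
    then show ?thesis using False unfolding rise_def by simp
  next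
    case True
    let ?a = "j - 1 - ?h"
    let ?Q = "if Suc ?h = j then UNIV else run P (j - 2 - ?h) (j - 1)"
    have a: "?a < j" "?a \<le> j - 1" using True by auto
    have eq: "rise E M P j v = P j \<inter> ?Q \<inter> E (run P ?a (j - 1)) ?m" using True by (simp add: rise_def)
    show ?thesis
    proof (cases "?m = M")
      case False
      then have dm: "Suc v mod Suc M = Suc ?m" "Suc v div Suc M = ?h"
        by (auto simp: mod_Suc div_Suc)
      then have eq': "rise E M P j (Suc v) = P j \<inter> ?Q \<inter> E (run P ?a (j - 1)) (Suc ?m)"
        using True by (simp add: rise_def)
      have "E (run P ?a (j - 1)) ?m \<subseteq> E (run P ?a (j - 1)) (Suc ?m)"
        using expansionsD[OF E, of ?a "j - 1"] a(2) j by auto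
      then show ?thesis using a(1) unfolding eq eq' by blast
    next
      case True': True
      then have dm: "Suc v mod Suc M = 0" "Suc v div Suc M = Suc ?h"
        by (auto simp: mod_Suc div_Suc)
      \<comment> \<open>Carry of the remainder: at stage \<open>M\<close> the expansion contains all
        of \<open>P j\<close>, so only the longer run still cuts. That run is stage 0 of the next
        expansion, and the set does not change.\<close>
      have v: "rise E M P j v = P j \<inter> ?Q" using full[OF a(1)] unfolding eq True' by blast
      have "rise E M P j (Suc v) = P j \<inter> ?Q"
      proof (cases "Suc ?h = j")
        case True then show ?thesis by (simp add: rise_def dm)
      next
        case False
        then have h: "Suc ?h < j" using \<open>?h < j\<close> by simp
        have e: "j - 1 - Suc ?h = j - 2 - ?h" using h by simp
        have "E (run P (j - 2 - ?h) (j - 1)) 0 = run P (j - 2 - ?h) (j - 1)"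
        proof -
          have "j - 2 - ?h \<le> j - 1 \<and> j - 1 < N" using j by auto
          then show ?thesis using expansionsD[OF E] by blast
        qed
        moreover have "run P (j - 2 - ?h) (j - 1) \<subseteq> run P (j - 2 - Suc ?h) (j - 1)"
          by (intro run_mono) auto
        ultimately show ?thesis using h False unfolding rise_def dm e by auto
      qed
      then show ?thesis using v by simp
    qed
  qed
qed

lemma rise_mono:
  assumes "expansions N P E" "j < N" "\<And>a. a < j \<Longrightarrow> P j \<subseteq> E (run P a (j - 1)) M" "v \<le> w"
  shows "rise E M P j v \<subseteq> rise E M P j w"
proof (rule lift_Suc_mono_le[OF _ assms(4)])
  show "rise E M P j n \<subseteq> rise E M P j (Suc n)" for n
    using rise_step[OF assms(1-3), of n] by auto
qed

lemma convex_Un_compact_meet: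
  fixes A B :: "'a::real_normed_vector set"
  assumes "compact A" "compact B" "A \<noteq> {}" "B \<noteq> {}" "convex (A \<union> B)"
  shows "A \<inter> B \<noteq> {}"
proof
  assume "A \<inter> B = {}"
  moreover have "connected (A \<union> B)" using assms(5) by (rule convex_connected)
  moreover have "closed A" "closed B" using assms(1,2) by (auto intro: compact_imp_closed)
  ultimately show False using assms(3,4) unfolding connected_closed by blast
qed

text \<open>The falling stages are the rising stages of the reversed chain. Consecutive blocks join
  at \<open>P j \<inter> P (Suc j)\<close>, which is nonempty because two compact nonempty sets with
  convex union meet. So the first cell of a block still lies in the preceding member;
  \<open>C (Suc q) \<subseteq> P (q div L)\<close> records this for the sweep, which moves on to the
  next cell before its block ends.\<close>

lemma slow_chain:
  fixes P :: "nat \<Rightarrow> 'a::real_normed_vector set"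
  assumes ch: "convex_chain N P" and P: "\<And>k. k < N \<Longrightarrow> compact (P k) \<and> P k \<noteq> {}"
    and E: "expansions N P E"
    and clo: "\<And>i j m. i \<le> j \<Longrightarrow> j < N \<Longrightarrow> closed (E (run P i j) m)"
    and small: "\<And>i j m x y. \<lbrakk>i \<le> j; j < N; x \<in> E (run P i j) (Suc m) - E (run P i j) m;
        y \<in> E (run P i j) (Suc m) - E (run P i j) m\<rbrakk> \<Longrightarrow> dist x y \<le> e"
    and full: "\<And>i j k. i \<le> j \<Longrightarrow> j < N \<Longrightarrow> k < N \<Longrightarrow> P k \<subseteq> E (run P i j) M"
  shows "\<exists>L>0. \<exists>C. convex_chain (N * L) C
    \<and> (\<forall>q<N * L. compact (C q) \<and> C q \<noteq> {} \<and> C q \<subseteq> P (q div L))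
    \<and> (\<forall>k<N. \<exists>q<N * L. C q = P k)
    \<and> (\<forall>q. Suc q < N * L \<longrightarrow> C (Suc q) \<subseteq> P (q div L)
        \<and> (\<forall>x\<in>(C q - C (Suc q)) \<union> (C (Suc q) - C q). \<forall>y\<in>(C q - C (Suc q)) \<union> (C (Suc q) - C q). dist x y \<le> e))"
proof -
  define P' where "P' k = P (N - 1 - k)" for k
  have ch': "convex_chain N P'" and E': "expansions N P' E"
    unfolding P'_def by (rule convex_chain_rev[OF ch], rule expansions_rev[OF E])
  have rv: "run P' a b = run P (N - 1 - b) (N - 1 - a)" if "a \<le> b" "b < N" for a b
    unfolding P'_def using that by (rule run_rev)
  \<comment> \<open>Enough stages for all members at once, since \<open>rise\<close> is complete
    from stage \<open>Suc M * j\<close> on.\<close>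
  define V where "V = Suc M * N"
  define U where "U = rise E M P"
  define D where "D j v = rise E M P' (N - 1 - j) v" for j v
  have fU: "P j \<subseteq> E (run P a (j - 1)) M" if "j < N" "a < j" for a j
    using full[of a "j - 1" j] that by simp
  have fD: "P' j \<subseteq> E (run P' a (j - 1)) M" if "j < N" "a < j" for a j
    using full[of "N - 1 - (j - 1)" "N - 1 - a" "N - 1 - j"] that
    by (subst rv) (auto simp: P'_def)
  have U_mono: "U j v \<subseteq> U j w" if "j < N" "v \<le> w" for j v w
    unfolding U_def using fU that by (intro rise_mono[OF E])
  have D_mono: "D j v \<subseteq> D j w" if "j < N" "v \<le> w" for j v w
  proof -
    have j': "N - 1 - j < N" using that by simp
    show ?thesis unfolding D_def by (rule rise_mono[OF E' j' fD[OF j'] that(2)])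
  qed
  have topU: "U j V = P j" if "j < N" for j
    unfolding U_def V_def using that by (intro rise_top mult_le_mono2) simp
  have topD: "D j V = P j" if "j < N" for j
  proof -
    have "rise E M P' (N - 1 - j) V = P' (N - 1 - j)"
      unfolding V_def using that by (intro rise_top mult_le_mono2) simp
    then show ?thesis using that by (simp add: D_def P'_def)
  qed
  have inU: "U j v \<in> rising_sets E P j" for j v unfolding U_def by (rule rise_in_rising_sets)
  have inD: "D j v \<in> falling_sets E N P j" if "j < N" for j v
    unfolding D_def falling_sets_rev[OF that, symmetric] P'_def by (rule rise_in_rising_sets)
  have inD': "D j v \<in> rising_sets E P' (N - 1 - j)" for j v
    unfolding D_def by (rule rise_in_rising_sets)
  define L where "L = 2 * Suc V"
  define C where "C q = (if q mod L \<le> V then U (q div L) (q mod L) else D (q div L) (L - 1 - q mod L))" for q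
  have L0: "L > 0" by (simp add: L_def)
  have chC: "convex_chain (N * L) C"
  proof (rule convex_chain_ramps[of N V U D P L C])
    show "convex (U j v)" if "j < N" for j v by (rule convex_rising[OF ch E that inU])
    show "convex (D j v)" if "j < N" for j v
      using that by (intro convex_rising[OF ch' E' _ inD']) auto
    show "convex (D i v \<union> run P (Suc i) (j - 1) \<union> U j w)" if "i < j" "j < N" for i j v w
      using that by (intro convex_falling_run_rising[OF ch E that inU inD]) auto
  qed (use U_mono D_mono topU topD in \<open>auto simp: L_def C_def\<close>)
  have closed_rising: "closed A" if "j < N" "A \<in> rising_sets E Q j" "\<And>k. k < N \<Longrightarrow> compact (Q k)"
    "\<And>i j m. i \<le> j \<Longrightarrow> j < N \<Longrightarrow> closed (E (run Q i j) m)" for A j and Q :: "nat \<Rightarrow> 'a set"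
  proof -
    have "closed (run Q a b)" if "b < N" for a b
      unfolding run_def using that \<open>\<And>k. k < N \<Longrightarrow> compact (Q k)\<close>
      by (intro closed_UN) (auto intro: compact_imp_closed)
    moreover have "closed (Q j)" using that by (auto intro: compact_imp_closed)
    ultimately show ?thesis using that by (auto simp: rising_sets_def intro!: closed_Int)
  qed
  have closedU: "closed (U j v)" if "j < N" for j v
    using closed_rising[OF that inU] P clo by blast
  have closedD: "closed (D j v)" if "j < N" for j v
  proof (rule closed_rising[OF _ inD'])
    show "N - 1 - j < N" using that by simp
    show "compact (P' k)" if "k < N" for k using that P by (simp add: P'_def)
    show "closed (E (run P' a b) m)" if "a \<le> b" "b < N" for a b m
      unfolding rv[OF that] using that by (intro clo) auto
  qed
  have meet: "P j \<inter> P (Suc j) \<noteq> {}" if "Suc j < N" for j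
  proof (rule convex_Un_compact_meet)
    show "convex (P j \<union> P (Suc j))"
      using convex_chainD[OF ch, of j "Suc j"] that by (simp add: run_Suc_right)
  qed (use P that in auto)
  have U0: "U (Suc j) 0 = P j \<inter> P (Suc j)" if "Suc j < N" for j
    unfolding U_def using rise_0[OF E, of "Suc j" M] that by simp
  have D0: "D j 0 = P j \<inter> P (Suc j)" if "Suc j < N" for j
  proof -
    have "N - 1 - (N - 1 - j - 1) = Suc j" "N - 1 - (N - 1 - j) = j" using that by auto
    then show ?thesis unfolding D_def using rise_0[OF E', of "N - 1 - j" M] that by (auto simp: P'_def)
  qed
  have neU: "U j v \<noteq> {}" if "j < N" for j v
  proof (cases j)
    case 0 then show ?thesis using P that by (auto simp: U_def rise_def)
  next
    case (Suc k) then show ?thesis using U0[of k] meet[of k] U_mono[of j 0 v] that by auto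
  qed
  have neD: "D j v \<noteq> {}" if "j < N" for j v
  proof (cases "Suc j < N")
    case False
    \<comment> \<open>The last member has index 0 in the reversed chain, where \<open>rise\<close>
      is constant.\<close>
    then have "j = N - 1" using that by simp
    then have "D j v = P j" by (simp add: D_def rise_def P'_def)
    then show ?thesis using P that by simp
  next
    case True then show ?thesis using D0[of j] meet[of j] D_mono[of j 0 v] by auto
  qed
  have qN: "q div L < N" if "q < N * L" for q using that by (rule less_mult_imp_div_less)
  have CP: "C q \<subseteq> P (q div L)" if "q < N * L" for q
    using rising_subset[OF inU] falling_subset[OF inD[OF qN[OF that]]] by (simp add: C_def)
  have cells: "compact (C q) \<and> C q \<noteq> {} \<and> C q \<subseteq> P (q div L)" if q: "q < N * L" for q
  proof -
    have "closed (C q)" "C q \<noteq> {}" using closedU closedD neU neD qN[OF q] by (auto simp: C_def)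
    moreover have "compact (P (q div L))" using P qN[OF q] by blast
    ultimately show ?thesis using CP[OF q] compact_Int_closed[of "P (q div L)" "C q"]
      by (simp add: Int_absorb1)
  qed
  have onto: "\<exists>q<N * L. C q = P k" if "k < N" for k
  proof -
    have "V < L" by (simp add: L_def)
    then have "C (k * L + V) = P k" using topU that by (simp add: C_def)
    moreover have "k * L + V < Suc k * L" using \<open>V < L\<close> by simp
    then have "k * L + V < N * L" using that by (meson Suc_leI less_le_trans mult_le_mono1)
    ultimately show ?thesis by blast
  qed
  have stepU: "dist x y \<le> e" if "j < N" "x \<in> U j (Suc v) - U j v" "y \<in> U j (Suc v) - U j v" for j v x y
  proof -
    note xy = that
    obtain a m where "a < j" "U j (Suc v) - U j v \<subseteq> E (run P a (j - 1)) (Suc m) - E (run P a (j - 1)) m"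
      using rise_step[OF E xy(1) fU[OF xy(1)], of v] xy(2) unfolding U_def by blast
    then have "a \<le> j - 1" "j - 1 < N" "x \<in> E (run P a (j - 1)) (Suc m) - E (run P a (j - 1)) m"
      "y \<in> E (run P a (j - 1)) (Suc m) - E (run P a (j - 1)) m" using xy by auto
    then show ?thesis by (rule small)
  qed
  have stepD: "dist x y \<le> e" if "j < N" "x \<in> D j (Suc v) - D j v" "y \<in> D j (Suc v) - D j v" for j v x y
  proof -
    note xy = that
    have j': "N - 1 - j < N" using xy(1) by simp
    obtain a m where am: "a < N - 1 - j"
      "D j (Suc v) - D j v \<subseteq> E (run P' a (N - 1 - j - 1)) (Suc m) - E (run P' a (N - 1 - j - 1)) m"
      using rise_step[OF E' j' fD[OF j'], of v] xy(2) unfolding D_def by blast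
    have "a \<le> N - 1 - j - 1" "N - 1 - j - 1 < N" using am(1) by auto
    note r = rv[OF this]
    show ?thesis
    proof (rule small)
      show "N - 1 - (N - 1 - j - 1) \<le> N - 1 - a" "N - 1 - a < N" using am(1) by auto
      show "x \<in> E (run P (N - 1 - (N - 1 - j - 1)) (N - 1 - a)) (Suc m) - E (run P (N - 1 - (N - 1 - j - 1)) (N - 1 - a)) m"
        "y \<in> E (run P (N - 1 - (N - 1 - j - 1)) (N - 1 - a)) (Suc m) - E (run P (N - 1 - (N - 1 - j - 1)) (N - 1 - a)) m"
        using am(2) xy(2,3) unfolding r by blast+
    qed
  qed
  have step: "C (Suc q) \<subseteq> P (q div L)
      \<and> (\<forall>x\<in>(C q - C (Suc q)) \<union> (C (Suc q) - C q). \<forall>y\<in>(C q - C (Suc q)) \<union> (C (Suc q) - C q). dist x y \<le> e)"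
    if q: "Suc q < N * L" for q
  proof -
    let ?j = "q div L" and ?v = "q mod L"
    have j: "?j < N" using q by (intro qN) simp
    have v: "?v < L" using L0 by simp
    have fin: "\<forall>x\<in>(A - B) \<union> (B - A). \<forall>y\<in>(A - B) \<union> (B - A). dist x y \<le> e"
      if "A \<subseteq> B" "\<And>x y. x \<in> B - A \<Longrightarrow> y \<in> B - A \<Longrightarrow> dist x y \<le> e" for A B :: "'a set"
      using that by (simp add: Diff_eq_empty_iff[THEN iffD2])
    have VL: "V < L" "Suc V < L" "L - 1 - Suc V = V" by (simp_all add: L_def)
    have dm: "Suc q mod L = Suc ?v" "Suc q div L = ?j" if "Suc ?v < L"
      using that by (simp_all add: mod_Suc div_Suc)
    have dm': "Suc q mod L = 0" "Suc q div L = Suc ?j" if "Suc ?v = L"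
      using that by (simp_all add: mod_Suc div_Suc)
    consider "?v < V" | "?v = V" | "V < ?v" "Suc ?v < L" | "Suc ?v = L" using v by linarith
    then show ?thesis
    proof cases
      case 1
      then have dm: "Suc q mod L = Suc ?v" "Suc q div L = ?j" using dm VL by auto
      have eq: "C q = U ?j ?v" "C (Suc q) = U ?j (Suc ?v)" using 1 unfolding C_def dm by simp_all
      have "U ?j ?v \<subseteq> U ?j (Suc ?v)" by (rule U_mono[OF j]) simp
      moreover have "C (Suc q) \<subseteq> P ?j" using CP[OF q] dm by simp
      ultimately show ?thesis unfolding eq by (intro conjI fin stepU[OF j])
    next
      case 2
      then have dm: "Suc q mod L = Suc V" "Suc q div L = ?j" using dm VL by auto
      have "C q = P ?j" "C (Suc q) = P ?j" using 2 topU[OF j] topD[OF j] VL(3) unfolding C_def dm by simp_all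
      then show ?thesis by simp
    next
      case 3
      then have dm: "Suc q mod L = Suc ?v" "Suc q div L = ?j" using dm by auto
      define w where "w = L - 2 - ?v"
      have w: "L - 1 - ?v = Suc w" "L - 1 - Suc ?v = w" using 3 by (auto simp: w_def)
      have eq: "C q = D ?j (Suc w)" "C (Suc q) = D ?j w" using 3 unfolding C_def dm w by simp_all
      have "D ?j w \<subseteq> D ?j (Suc w)" by (rule D_mono[OF j]) simp
      moreover have "C (Suc q) \<subseteq> P ?j" using CP[OF q] dm by simp
      ultimately show ?thesis unfolding eq Un_commute[of "D ?j (Suc w) - D ?j w"] by (intro conjI fin stepD[OF j])
    next
      case 4
      note dm = dm'[OF 4]
      have j': "Suc ?j < N" using qN[OF q] unfolding dm .
      have "\<not> ?v \<le> V" "L - 1 - ?v = 0" using 4 VL by auto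
      then have "C q = P ?j \<inter> P (Suc ?j)" "C (Suc q) = P ?j \<inter> P (Suc ?j)"
        using D0[OF j'] U0[OF j'] unfolding C_def dm by simp_all
      then show ?thesis by simp
    qed
  qed
  show ?thesis using L0 chC cells onto step by blast
qed

subsection \<open>Cutting chains by strips\<close>

text \<open>Union and intersection commute here. A point of \<open>C a\<close> and
  \<open>J b\<close> is followed from index \<open>a\<close> towards \<open>b\<close>: either it
  stays in the sets \<open>C\<close> until \<open>b\<close>, or \<open>step\<close> puts it into the
  set \<open>J\<close> belonging to the last index before it is lost.\<close>

lemma convex_chain_Int:
  fixes C J :: "nat \<Rightarrow> 'a::real_vector set"
  assumes "convex_chain N C" "convex_chain N J"
    and step: "\<And>t. Suc t < N \<Longrightarrow> C (Suc t) - C t \<subseteq> J (Suc t) \<and> C t - C (Suc t) \<subseteq> J t"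
  shows "convex_chain N (\<lambda>t. C t \<inter> J t)"
  unfolding convex_chain_def
proof (intro allI impI)
  fix i j assume ij: "i \<le> j \<and> j < N"
  have fwd: "\<exists>t\<in>{a..a + n}. x \<in> C t \<inter> J t" if "x \<in> C a" "x \<in> J (a + n)" "a + n < N" for a n x
    using that
  proof (induction n arbitrary: a)
    case (Suc n)
    show ?case
    proof (cases "x \<in> C (Suc a)")
      case True
      then have "\<exists>t\<in>{Suc a..Suc a + n}. x \<in> C t \<inter> J t" using Suc by (intro Suc.IH) auto
      then show ?thesis by fastforce
    next
      case False
      then have "x \<in> J a" using step[of a] Suc.prems by auto
      then show ?thesis using Suc.prems by (intro bexI[of _ a]) auto
    qed
  qed auto
  have bwd: "\<exists>t\<in>{b..b + n}. x \<in> C t \<inter> J t" if "x \<in> J b" "x \<in> C (b + n)" "b + n < N" for b n x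
    using that
  proof (induction n)
    case (Suc n)
    show ?case
    proof (cases "x \<in> C (b + n)")
      case True
      then have "\<exists>t\<in>{b..b + n}. x \<in> C t \<inter> J t" using Suc by (intro Suc.IH) auto
      then show ?thesis by fastforce
    next
      case False
      then have "x \<in> J (b + Suc n)" using step[of "b + n"] Suc.prems by auto
      then show ?thesis using Suc.prems by (intro bexI[of _ "b + Suc n"]) auto
    qed
  qed auto
  have "run (\<lambda>t. C t \<inter> J t) i j = run C i j \<inter> run J i j"
  proof (intro equalityI subsetI)
    fix x assume "x \<in> run C i j \<inter> run J i j"
    then obtain a b where ab: "a \<in> {i..j}" "x \<in> C a" "b \<in> {i..j}" "x \<in> J b" by (auto simp: run_def)
    have "\<exists>t\<in>{i..j}. x \<in> C t \<inter> J t"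
    proof (cases "a \<le> b")
      case True
      then show ?thesis using fwd[of x a "b - a"] ab ij by fastforce
    next
      case False
      then show ?thesis using bwd[of x b "a - b"] ab ij by fastforce
    qed
    then show "x \<in> run (\<lambda>t. C t \<inter> J t) i j" by (auto simp: run_def)
  qed (auto simp: run_def)
  then show "convex (run (\<lambda>t. C t \<inter> J t) i j)"
    using assms(1,2) ij by (simp add: convex_chain_def convex_Int)
qed

text \<open>A monotone reparametrisation with increments 0 and 1 skips no index, so it maps index
  intervals onto index intervals.\<close>

lemma convex_chain_pullback:
  fixes C :: "nat \<Rightarrow> 'a::real_vector set"
  assumes C: "convex_chain N C" and lt: "\<And>t. t < N' \<Longrightarrow> \<sigma> t < N"
    and step: "\<And>t. Suc t < N' \<Longrightarrow> \<sigma> t \<le> \<sigma> (Suc t) \<and> \<sigma> (Suc t) \<le> Suc (\<sigma> t)"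
  shows "convex_chain N' (\<lambda>t. C (\<sigma> t))"
  unfolding convex_chain_def
proof (intro allI impI)
  fix i j assume ij: "i \<le> j \<and> j < N'"
  have "i + n < N' \<Longrightarrow> \<sigma> i \<le> \<sigma> (i + n) \<and> \<sigma> ` {i..i + n} = {\<sigma> i..\<sigma> (i + n)}" for n
  proof (induction n)
    case (Suc n)
    then have IH: "\<sigma> i \<le> \<sigma> (i + n)" "\<sigma> ` {i..i + n} = {\<sigma> i..\<sigma> (i + n)}" by auto
    have st: "\<sigma> (Suc (i + n)) = \<sigma> (i + n) \<or> \<sigma> (Suc (i + n)) = Suc (\<sigma> (i + n))"
      using step[of "i + n"] Suc.prems by auto
    have "{i..i + Suc n} = insert (Suc (i + n)) {i..i + n}" by auto
    then have "\<sigma> ` {i..i + Suc n} = insert (\<sigma> (Suc (i + n))) {\<sigma> i..\<sigma> (i + n)}" using IH by simp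
    then show ?case using st IH by auto
  qed simp
  from this[of "j - i"] have "\<sigma> i \<le> \<sigma> j" "\<sigma> ` {i..j} = {\<sigma> i..\<sigma> j}" using ij by auto
  then have "run (\<lambda>t. C (\<sigma> t)) i j = run C (\<sigma> i) (\<sigma> j)" unfolding run_def by (metis image_image)
  then show "convex (run (\<lambda>t. C (\<sigma> t)) i j)"
    using convex_chainD[OF C \<open>\<sigma> i \<le> \<sigma> j\<close>] lt ij by auto
qed

text \<open>The centres move by at most \<open>e\<close> while the half-width is
  \<open>2 * e\<close>, so consecutive strips overlap and the union of their projections to the
  direction \<open>b\<close> is an interval.\<close>

lemma convex_chain_strips:
  fixes b :: "'a::real_inner"
  assumes e: "e > 0" and step: "\<And>t. Suc t < N \<Longrightarrow> \<phi> (Suc t) \<le> Suc (\<phi> t) \<and> \<phi> t \<le> Suc (\<phi> (Suc t))"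
  shows "convex_chain N (\<lambda>t. {x. \<bar>x \<bullet> b + R - real (\<phi> t) * e\<bar> \<le> 2 * e})"
  unfolding convex_chain_def
proof (intro allI impI)
  fix i j assume ij: "i \<le> j \<and> j < N"
  let ?I = "\<lambda>t. {real (\<phi> t) * e - 2 * e..real (\<phi> t) * e + 2 * e}"
  have "i + n < N \<Longrightarrow> connected (run ?I i (i + n))" for n
  proof (induction n)
    case (Suc n)
    have d: "\<bar>real (\<phi> (Suc (i + n))) - real (\<phi> (i + n))\<bar> \<le> 1" using step[of "i + n"] Suc.prems by auto
    have "\<bar>real (\<phi> (Suc (i + n))) * e - real (\<phi> (i + n)) * e\<bar> = \<bar>real (\<phi> (Suc (i + n))) - real (\<phi> (i + n))\<bar> * e"
      using e by (simp add: abs_mult flip: left_diff_distrib)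
    also have "\<dots> \<le> 1 * e" using d e by (intro mult_right_mono) auto
    finally have "real (\<phi> (i + n)) * e \<in> ?I (Suc (i + n))" using e by auto
    moreover have "real (\<phi> (i + n)) * e \<in> run ?I i (i + n)"
      using e unfolding run_def by (intro UN_I[of "i + n"]) auto
    ultimately have "run ?I i (i + n) \<inter> ?I (Suc (i + n)) \<noteq> {}" by blast
    moreover have "connected (run ?I i (i + n))" using Suc by simp
    ultimately have "connected (run ?I i (i + n) \<union> ?I (Suc (i + n)))"
      by (intro connected_Un) (auto simp: connected_Icc)
    then show ?case by (simp add: run_Suc_right)
  qed simp
  from this[of "j - i"] have "convex (run ?I i j)" using ij by (simp add: is_interval_convex_1[symmetric] is_interval_connected_1)
  then have "convex ((\<lambda>x. x \<bullet> b) -` ((+) (- R) ` run ?I i j))"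
    by (intro convex_linear_vimage convex_translation)
      (auto intro!: linearI simp: inner_add_left)
  moreover have "(\<lambda>x. x \<bullet> b) -` ((+) (- R) ` run ?I i j) = run (\<lambda>t. {x. \<bar>x \<bullet> b + R - real (\<phi> t) * e\<bar> \<le> 2 * e}) i j"
  proof (intro equalityI subsetI)
    fix x assume "x \<in> run (\<lambda>t. {x. \<bar>x \<bullet> b + R - real (\<phi> t) * e\<bar> \<le> 2 * e}) i j"
    then obtain t where "t \<in> {i..j}" "\<bar>x \<bullet> b + R - real (\<phi> t) * e\<bar> \<le> 2 * e" by (auto simp: run_def)
    then have "x \<bullet> b + R \<in> run ?I i j" unfolding run_def by (intro UN_I[of t]) (auto simp: abs_le_iff)
    then show "x \<in> (\<lambda>x. x \<bullet> b) -` ((+) (- R) ` run ?I i j)" by force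
  next
    fix x assume "x \<in> (\<lambda>x. x \<bullet> b) -` ((+) (- R) ` run ?I i j)"
    then have "x \<bullet> b + R \<in> run ?I i j" by auto
    then obtain t where "t \<in> {i..j}" "x \<bullet> b + R \<in> ?I t" by (auto simp only: run_def)
    then show "x \<in> run (\<lambda>t. {x. \<bar>x \<bullet> b + R - real (\<phi> t) * e\<bar> \<le> 2 * e}) i j"
      unfolding run_def by (intro UN_I[of t]) (auto simp: abs_le_iff)
  qed
  ultimately show "convex (run (\<lambda>t. {x. \<bar>x \<bullet> b + R - real (\<phi> t) * e\<bar> \<le> 2 * e}) i j)" by simp
qed

text \<open>Empty cells are replaced by the closest preceding nonempty cell of the same block or, failing
  that, by the first nonempty one.\<close>

lemma convex_chain_fill:
  fixes F :: "nat \<Rightarrow> 'a::real_vector set"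
  assumes F: "convex_chain (Q * B) F" and B: "B > 0"
    and ne: "\<And>q. q < Q \<Longrightarrow> \<exists>t. t div B = q \<and> F t \<noteq> {}"
  shows "\<exists>\<pi>. convex_chain (Q * B) (\<lambda>t. F (\<pi> t)) \<and> (\<forall>t. F t \<noteq> {} \<longrightarrow> \<pi> t = t)
    \<and> (\<forall>t<Q * B. \<pi> t div B = t div B \<and> F (\<pi> t) \<noteq> {})"
proof -
  let ?S = "\<lambda>t p. p \<le> t \<and> p div B = t div B \<and> F p \<noteq> {}"
  let ?A = "\<lambda>t p. p div B = t div B \<and> F p \<noteq> {}"
  define \<pi> where "\<pi> t = (if \<exists>p. ?S t p then GREATEST p. ?S t p else LEAST p. ?A t p)" for t
  have G: "?S t (\<pi> t) \<and> (\<forall>p. ?S t p \<longrightarrow> p \<le> \<pi> t)" if "\<exists>p. ?S t p" for t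
  proof -
    from that obtain p where p: "?S t p" by blast
    have "?S t (GREATEST p. ?S t p)" using p by (intro GreatestI_nat[of "?S t" p t]) auto
    moreover have "p \<le> (GREATEST p. ?S t p)" if "?S t p" for p
      using that by (intro Greatest_le_nat[of "?S t" p t]) auto
    ultimately show ?thesis using that unfolding \<pi>_def by auto
  qed
  have Lq: "?A t (\<pi> t) \<and> (\<forall>p. ?A t p \<longrightarrow> \<pi> t \<le> p) \<and> t < \<pi> t" if "\<not> (\<exists>p. ?S t p)" "t < Q * B" for t
  proof -
    have eq: "\<pi> t = (LEAST p. ?A t p)" unfolding \<pi>_def using that(1) by (rule if_not_P)
    have "t div B < Q" using that(2) by (rule less_mult_imp_div_less)
    then obtain p where p: "?A t p" using ne by blast
    have "?A t (\<pi> t)" unfolding eq by (rule LeastI[of "?A t", OF p])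
    moreover have "\<pi> t \<le> p" if "?A t p" for p unfolding eq using that by (rule Least_le)
    ultimately show ?thesis using that(1) by (meson not_le)
  qed
  have id: "\<pi> t = t" if "F t \<noteq> {}" for t
  proof -
    have S: "?S t t" using that by simp
    then have "\<exists>p. ?S t p" by blast
    from G[OF this] S show ?thesis by (intro antisym) blast+
  qed
  have blk: "\<pi> t div B = t div B \<and> F (\<pi> t) \<noteq> {}" if "t < Q * B" for t
    using G[of t] Lq[OF _ that] by (cases "\<exists>p. ?S t p") auto
  have le: "\<pi> s \<le> \<pi> t" if "s \<le> t" "t < Q * B" for s t
  proof (cases "s div B = t div B")
    case False
    then have "s div B < t div B" using div_le_mono[OF that(1)] by (metis le_neq_implies_less)
    then have "\<pi> s div B < \<pi> t div B" using blk that by simp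
    then show ?thesis using div_le_mono[of "\<pi> t" "\<pi> s" B] by linarith
  next
    case True
    have s: "s < Q * B" using that by simp
    show ?thesis
    proof (cases "\<exists>p. ?S s p")
      case S: True
      then have *: "?S t (\<pi> s)" using G[OF S] True that by auto
      then have "\<exists>p. ?S t p" by blast
      from G[OF this] * show ?thesis by blast
    next
      case False
      have "?A s (\<pi> t)" using blk[OF that(2)] True by simp
      then show ?thesis using Lq[OF False s] by blast
    qed
  qed
  have "convex_chain (Q * B) (\<lambda>t. F (\<pi> t))"
    unfolding convex_chain_def
  proof (intro allI impI)
    fix i j assume ij: "i \<le> j \<and> j < Q * B"
    \<comment> \<open>A nonempty cell between the two chosen indices belongs to the index interval,
      or else it is one of the two chosen cells by their extremality.\<close>
    have mem: "\<exists>k\<in>{i..j}. \<pi> k = p" if p: "\<pi> i \<le> p" "p \<le> \<pi> j" "F p \<noteq> {}" for p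
    proof -
      consider "i \<le> p" "p \<le> j" | "p < i" | "j < p" by linarith
      then show ?thesis
      proof cases
        case 1 then show ?thesis using id[OF p(3)] by auto
      next
        case 2
        have "i < Q * B" using ij by simp
        have "\<exists>q. ?S i q"
        proof (rule ccontr)
          assume "\<not> ?thesis"
          then have "i < \<pi> i" using Lq \<open>i < Q * B\<close> by blast
          then show False using p(1) 2 by simp
        qed
        note g = G[OF this]
        have "p div B = i div B" using g div_le_mono[OF p(1), of B] div_le_mono[of p i B] 2 by simp
        then have "?S i p" using p 2 by simp
        then have "p = \<pi> i" using g p(1) by (intro antisym) blast+
        then show ?thesis using ij by auto
      next
        case 3
        have "\<not> (\<exists>q. ?S j q)"
        proof
          assume "\<exists>q. ?S j q"
          then have "\<pi> j \<le> j" using G by blast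
          then show False using p(2) 3 by simp
        qed
        moreover have "j < Q * B" using ij by simp
        ultimately have g: "?A j (\<pi> j)" "\<And>q. ?A j q \<Longrightarrow> \<pi> j \<le> q" using Lq by blast+
        have "p div B = j div B" using g(1) div_le_mono[OF p(2), of B] div_le_mono[of j p B] 3 by simp
        then have "?A j p" using p by simp
        then have "p = \<pi> j" using g(2) p(2) by (intro antisym) blast+
        then show ?thesis using ij by auto
      qed
    qed
    have "run (\<lambda>t. F (\<pi> t)) i j = run F (\<pi> i) (\<pi> j)"
    proof (intro equalityI subsetI)
      fix x assume "x \<in> run (\<lambda>t. F (\<pi> t)) i j"
      then show "x \<in> run F (\<pi> i) (\<pi> j)" using le ij by (auto simp: run_def)
    next
      fix x assume "x \<in> run F (\<pi> i) (\<pi> j)"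
      then obtain p where "p \<in> {\<pi> i..\<pi> j}" "x \<in> F p" by (auto simp: run_def)
      then show "x \<in> run (\<lambda>t. F (\<pi> t)) i j" using mem[of p] by (auto simp: run_def)
    qed
    moreover have "\<pi> i \<le> \<pi> j" using le ij by blast
    moreover have "\<pi> j < Q * B"
    proof -
      have "\<pi> j div B < Q" using blk[of j] ij by (auto intro: less_mult_imp_div_less)
      then show ?thesis using B by (simp add: div_less_iff_less_mult)
    qed
    ultimately show "convex (run (\<lambda>t. F (\<pi> t)) i j)" using convex_chainD[OF F] by simp
  qed
  then show ?thesis using id blk by blast
qed

text \<open>A slow chain is cut into thin cells by sweeping a strip back and forth: between \<open>C q\<close> and
  \<open>C (Suc q)\<close> the strip index runs up to \<open>K - 1\<close> and back to \<open>0\<close>, and the switch to \<open>C (Suc q)\<close>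
  happens on the way back, in the two strips that contain the symmetric difference.\<close>

lemma strip_walk:
  fixes C :: "nat \<Rightarrow> 'a::real_inner set"
  assumes C: "convex_chain Q C" and K: "K > 0" and e: "e > 0"
    and J: "\<And>s. J s = {x. \<bar>x \<bullet> b + R - real s * e\<bar> \<le> 2 * e}"
    and s: "\<And>q. Suc q < Q \<Longrightarrow> Suc (s q) < K \<and> C (Suc q) - C q \<subseteq> J (s q) \<and> C q - C (Suc q) \<subseteq> J (Suc (s q))"
  shows "\<exists>\<sigma> \<phi>. convex_chain (Q * (2 * K)) (\<lambda>t. C (\<sigma> t) \<inter> J (\<phi> t))
    \<and> (\<forall>t<Q * (2 * K). \<sigma> t = t div (2 * K) \<or> \<sigma> t = Suc (t div (2 * K)) \<and> \<sigma> t < Q)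
    \<and> (\<forall>q i. i < K \<longrightarrow> \<sigma> (q * (2 * K) + i) = q \<and> \<phi> (q * (2 * K) + i) = i)"
proof -
  define n where "n = 2 * K"
  have n: "n > 0" "K < n" using K by (auto simp: n_def)
  \<comment> \<open>Within a block the strip index is
    \<open>0, ..., K - 1, K - 1, ..., 0\<close>.\<close>
  define \<phi> where "\<phi> t = min (t mod n) (n - 1 - t mod n)" for t
  \<comment> \<open>The switch happens on the way back as soon as the strip index is at most
    \<open>s q\<close>. The block ends with index 0, so a block with a successor has switched by
    then, and the passage to the next block changes no cell.\<close>
  define late where "late q w \<longleftrightarrow> w \<ge> K \<and> n - 1 - w \<le> s q \<and> Suc q < Q" for q w
  define \<sigma> where "\<sigma> t = (if late (t div n) (t mod n) then Suc (t div n) else t div n)" for t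
  have Suc_in: "Suc t mod n = Suc (t mod n)" "Suc t div n = t div n" if "Suc (t mod n) < n" for t
    using that by (simp_all add: mod_Suc div_Suc)
  have Suc_out: "Suc t mod n = 0" "Suc t div n = Suc (t div n)" if "Suc (t mod n) = n" for t
    using that by (simp_all add: mod_Suc div_Suc)
  have tcases: "Suc (t mod n) < n \<or> Suc (t mod n) = n" for t
    using mod_less_divisor[OF n(1), of t] by linarith
  have last: "late (t div n) (t mod n)" "\<sigma> t = Suc (t div n)" "\<sigma> (Suc t) = Suc (t div n)"
    if "Suc (t mod n) = n" "Suc t < Q * n" for t
  proof -
    have "Suc (t div n) < Q" using that Suc_out(2)[OF that(1)] less_mult_imp_div_less[of "Suc t" Q n] by simp
    then show l: "late (t div n) (t mod n)" using that(1) n(2) by (auto simp: late_def)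
    then show "\<sigma> t = Suc (t div n)" by (simp add: \<sigma>_def)
    have "\<not> late q 0" for q using K by (simp add: late_def)
    then show "\<sigma> (Suc t) = Suc (t div n)" unfolding \<sigma>_def Suc_out[OF that(1)] by simp
  qed
  have late_mono: "late q (Suc w)" if "late q w" for q w using that by (auto simp: late_def)
  have \<sigma>_step: "\<sigma> t \<le> \<sigma> (Suc t) \<and> \<sigma> (Suc t) \<le> Suc (\<sigma> t)" if t: "Suc t < Q * n" for t
  proof (cases "Suc (t mod n) < n")
    case True
    then show ?thesis using late_mono[of "t div n" "t mod n"] unfolding \<sigma>_def Suc_in[OF True] by simp
  next
    case False then show ?thesis using last[of t] t tcases[of t] by simp
  qed
  have \<phi>_step: "\<phi> (Suc t) \<le> Suc (\<phi> t) \<and> \<phi> t \<le> Suc (\<phi> (Suc t))" for t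
  proof (cases "Suc (t mod n) < n")
    case True then show ?thesis unfolding \<phi>_def Suc_in[OF True] by auto
  next
    case False
    then have *: "Suc (t mod n) = n" using tcases[of t] by simp
    then show ?thesis unfolding \<phi>_def Suc_out[OF *] by auto
  qed
  have \<sigma>: "\<sigma> t = t div n \<or> \<sigma> t = Suc (t div n) \<and> \<sigma> t < Q" for t
    by (auto simp: \<sigma>_def late_def)
  have \<sigma>_less: "\<sigma> t < Q" if "t < Q * n" for t
    using \<sigma>[of t] less_mult_imp_div_less[OF that] by auto
  have diff: "C (\<sigma> (Suc t)) - C (\<sigma> t) \<subseteq> J (\<phi> (Suc t)) \<and> C (\<sigma> t) - C (\<sigma> (Suc t)) \<subseteq> J (\<phi> t)"
    if t: "Suc t < Q * n" for t
  proof (cases "\<sigma> (Suc t) = \<sigma> t")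
    case False
    let ?q = "t div n" and ?w = "t mod n"
    have w: "Suc ?w < n" using False last[of t] t tcases[of t] by auto
    have l: "late ?q (Suc ?w)" "\<not> late ?q ?w"
      using False late_mono[of ?q ?w] unfolding \<sigma>_def Suc_in[OF w] by (auto split: if_splits)
    then have q: "\<sigma> t = ?q" "\<sigma> (Suc t) = Suc ?q" unfolding \<sigma>_def Suc_in[OF w] by simp_all
    have Q: "Suc ?q < Q" using l by (simp add: late_def)
    have sK: "Suc (s ?q) < K" using s[OF Q] by simp
    have "Suc ?w \<ge> K" "n - 1 - Suc ?w \<le> s ?q" "K \<le> ?w \<longrightarrow> s ?q < n - 1 - ?w"
      using l Q by (auto simp: late_def not_le)
    then have "K \<le> ?w" "n - 1 - ?w = Suc (s ?q)" using sK by (auto simp: n_def)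
    \<comment> \<open>The switch falls between the strips \<open>Suc (s q)\<close> and
      \<open>s q\<close>: points that leave lie in the former, points that enter in the latter, as
      \<open>convex_chain_Int\<close> demands.\<close>
    then have "\<phi> t = Suc (s ?q)" "\<phi> (Suc t) = s ?q"
      using sK w unfolding \<phi>_def Suc_in[OF w] by (auto simp: n_def)
    then show ?thesis using s[OF Q] q by simp
  qed simp
  have "convex_chain (Q * n) (\<lambda>t. C (\<sigma> t) \<inter> J (\<phi> t))"
  proof (rule convex_chain_Int)
    show "convex_chain (Q * n) (\<lambda>t. C (\<sigma> t))"
      using \<sigma>_less \<sigma>_step by (rule convex_chain_pullback[OF C])
    show "convex_chain (Q * n) (\<lambda>t. J (\<phi> t))"
      unfolding J using \<phi>_step by (rule convex_chain_strips[OF e])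
  qed (rule diff)
  moreover have "\<sigma> (q * n + i) = q \<and> \<phi> (q * n + i) = i" if "i < K" for q i
    using that n by (auto simp: \<sigma>_def \<phi>_def late_def n_def)
  ultimately show ?thesis using \<sigma> unfolding n_def by blast
qed

section \<open>Bulged chains together with growing bodies for all their runs\<close>

lemma bulged_expansions:
  fixes P :: "nat \<Rightarrow> 'a::euclidean_space set"
  assumes ch: "convex_chain N P" and P: "\<And>k. k < N \<Longrightarrow> compact (P k) \<and> P k \<noteq> {}"
    and r: "r > 0" and e: "e > 0"
  shows "\<exists>B R E M. R > 0 \<and> convex_chain N B \<and> expansions N B E
    \<and> (\<forall>k<N. compact (B k) \<and> P k \<subseteq> B k \<and> B k \<subseteq> (\<Union>x\<in>P k. cball x r) \<and> B k \<subseteq> cball 0 R)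
    \<and> (\<forall>i j m. i \<le> j \<and> j < N \<longrightarrow> closed (E (run B i j) m) \<and> (E (run B i j) m, E (run B i j) (Suc m)) \<in> small_step e)
    \<and> (\<forall>i j. i \<le> j \<and> j < N \<longrightarrow> cball 0 R \<subseteq> E (run B i j) M)"
proof -
  have "compact (\<Union>k<N. P k)" using P by (intro compact_UN) auto
  then obtain R0 where R0: "R0 > 0" "\<And>k x. k < N \<Longrightarrow> x \<in> P k \<Longrightarrow> norm x \<le> R0"
    using bounded_pos[of "\<Union>k<N. P k"] compact_imp_bounded by auto
  \<comment> \<open>With this \<open>c\<close> the term \<open>c * (norm x)\<^sup>2\<close> is at
    most \<open>r\<^sup>2 / 2\<close> on all members, so every point of \<open>P k\<close> is
    interior to the bulge of \<open>P k\<close>.\<close>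
  define c where "c = r\<^sup>2 / (2 * R0\<^sup>2)"
  have c: "c > 0" using r R0 by (simp add: c_def)
  have cn: "c * (norm x)\<^sup>2 < r\<^sup>2" if "k < N" "x \<in> P k" for k x
  proof -
    have "c * (norm x)\<^sup>2 \<le> c * R0\<^sup>2" using c R0(2)[OF that] by (intro mult_left_mono power_mono) auto
    also have "\<dots> = r\<^sup>2 / 2" using R0 by (simp add: c_def)
    also have "\<dots> < r\<^sup>2" using r by simp
    finally show ?thesis .
  qed
  define B where "B k = bulge r c (P k)" for k
  define R where "R = R0 + r"
  have run: "run B i j = bulge r c (run P i j)" for i j by (simp add: run_def B_def bulge_UN)
  have runP: "compact (run P i j) \<and> convex (run P i j)" if "i \<le> j" "j < N" for i j
    using P that convex_chainD[OF ch that] by (auto simp: run_def intro!: compact_UN)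
  have B: "compact (B k)" "P k \<subseteq> B k" "B k \<subseteq> (\<Union>x\<in>P k. cball x r)" "B k \<subseteq> cball 0 R" if "k < N" for k
  proof -
    show "compact (B k)" unfolding B_def using P[OF that] c r by (intro compact_bulge) auto
    show "P k \<subseteq> B k" using bulge_interiorI[of _ "P k" _ c r] cn[OF that] interior_subset[of "B k"]
      unfolding B_def by fastforce
    show 1: "B k \<subseteq> (\<Union>x\<in>P k. cball x r)" unfolding B_def using c r by (intro bulge_subset_cballs) auto
    show "B k \<subseteq> cball 0 R"
    proof
      fix y assume "y \<in> B k"
      then obtain x where x: "x \<in> P k" "norm (x - y) \<le> r" using 1 by (auto simp: dist_norm)
      then have "norm y \<le> norm x + norm (x - y)" by (metis norm_triangle_sub norm_minus_commute)
      then show "y \<in> cball 0 R" using x R0(2)[OF that x(1)] by (simp add: R_def)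
    qed
  qed
  have chB: "convex_chain N B" unfolding convex_chain_def run
    using runP c by (auto intro!: convex_bulge)
  let ?W = "\<lambda>i j. run B i j"
  have "\<forall>X. \<exists>E M. (\<exists>i j. i \<le> j \<and> j < N \<and> X = ?W i j) \<longrightarrow> E 0 = X \<and> (\<forall>m. (E m, E (Suc m)) \<in> small_step e)
    \<and> (\<forall>m. closed (E m) \<and> convex (E m)) \<and> (\<forall>m\<ge>M. cball 0 R \<subseteq> E m)"
  proof
    fix X :: "'a set"
    show "\<exists>E M. (\<exists>i j. i \<le> j \<and> j < N \<and> X = ?W i j) \<longrightarrow> E 0 = X \<and> (\<forall>m. (E m, E (Suc m)) \<in> small_step e)
      \<and> (\<forall>m. closed (E m) \<and> convex (E m)) \<and> (\<forall>m\<ge>M. cball 0 R \<subseteq> E m)"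
    proof (cases "\<exists>i j. i \<le> j \<and> j < N \<and> X = ?W i j")
      case True
      then obtain i j where ij: "i \<le> j" "j < N" and X: "X = bulge r c (run P i j)" by (auto simp: run)
      obtain x where x: "x \<in> P i" using P[of i] ij by auto
      then have "x \<in> interior X"
        unfolding X using ij cn[of i x] by (intro bulge_interiorI[of x]) (auto simp: run_def)
      then show ?thesis
        using exhausting_sequence[of X e R] runP[OF ij] c r e unfolding X
        by (auto simp: compact_bulge convex_bulge strictly_convex_bulge)
    next
      case False then show ?thesis by blast
    qed
  qed
  then obtain E Mf where EM: "\<And>X. (\<exists>i j. i \<le> j \<and> j < N \<and> X = ?W i j) \<Longrightarrow> E X 0 = X
      \<and> (\<forall>m. (E X m, E X (Suc m)) \<in> small_step e)
      \<and> (\<forall>m. closed (E X m) \<and> convex (E X m)) \<and> (\<forall>m\<ge>Mf X. cball 0 R \<subseteq> E X m)"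
    by metis
  \<comment> \<open>A common bound for the finitely many runs; the sum dominates each stage
    number.\<close>
  define M where "M = (\<Sum>p\<in>{..<N} \<times> {..<N}. Mf (?W (fst p) (snd p)))"
  have M: "Mf (?W i j) \<le> M" if "i \<le> j" "j < N" for i j
    using that member_le_sum[of "(i, j)" "{..<N} \<times> {..<N}" "\<lambda>p. Mf (?W (fst p) (snd p))"]
    by (auto simp: M_def)
  have EW: "E (?W i j) 0 = ?W i j" "(E (?W i j) m, E (?W i j) (Suc m)) \<in> small_step e"
    "closed (E (?W i j) m)" "convex (E (?W i j) m)" "cball 0 R \<subseteq> E (?W i j) M" if "i \<le> j" "j < N" for i j m
  proof -
    have "\<exists>i' j'. i' \<le> j' \<and> j' < N \<and> ?W i j = ?W i' j'" using that by blast
    note EM[OF this]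
    then show "E (?W i j) 0 = ?W i j" "(E (?W i j) m, E (?W i j) (Suc m)) \<in> small_step e"
      "closed (E (?W i j) m)" "convex (E (?W i j) m)" "cball 0 R \<subseteq> E (?W i j) M"
      using M[OF that] by blast+
  qed
  have "E (?W i j) m \<subseteq> E (?W i j) (Suc m)" if "i \<le> j" "j < N" for i j m
    using EW(2)[OF that, of m] by (simp add: small_step_def)
  then have "expansions N B E" unfolding expansions_def using EW(1,4) by blast
  moreover have "R > 0" using R0 r by (simp add: R_def)
  moreover have "\<forall>k<N. compact (B k) \<and> P k \<subseteq> B k \<and> B k \<subseteq> (\<Union>x\<in>P k. cball x r) \<and> B k \<subseteq> cball 0 R"
    by (intro allI impI conjI B)
  moreover have "\<forall>i j m. i \<le> j \<and> j < N \<longrightarrow> closed (E (?W i j) m) \<and> (E (?W i j) m, E (?W i j) (Suc m)) \<in> small_step e"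
    using EW(2,3) by simp
  moreover have "\<forall>i j. i \<le> j \<and> j < N \<longrightarrow> cball 0 R \<subseteq> E (?W i j) M"
    using EW(5) by simp
  ultimately show ?thesis using chB
    by (intro exI[of _ B] exI[of _ R] exI[of _ E] exI[of _ M] conjI)
qed

subsection \<open>Refinement to small cells\<close>

definition cell_chain :: "nat \<Rightarrow> (nat \<Rightarrow> 'a::euclidean_space set) \<Rightarrow> bool" where
  "cell_chain N P \<longleftrightarrow> N > 0 \<and> convex_chain N P \<and> (\<forall>k<N. compact (P k) \<and> P k \<noteq> {})"

text \<open>The cells with \<open>t div m = k\<close> replace \<open>P k\<close>; the slack
  \<open>r\<close> pays for the bulging.\<close>

definition refinement ::
  "real \<Rightarrow> nat \<Rightarrow> (nat \<Rightarrow> 'a::euclidean_space set) \<Rightarrow> nat \<Rightarrow> (nat \<Rightarrow> 'a set) \<Rightarrow> bool" where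
  "refinement r N P m F \<longleftrightarrow> m > 0 \<and> cell_chain (N * m) F
    \<and> (\<forall>t<N * m. F t \<subseteq> (\<Union>x\<in>P (t div m). cball x r)) \<and> (\<Union>k<N. P k) \<subseteq> (\<Union>t<N * m. F t)"

lemma refinementD:
  assumes "refinement r N P m F"
  shows "m > 0" "cell_chain (N * m) F" "\<And>t. t < N * m \<Longrightarrow> F t \<subseteq> (\<Union>x\<in>P (t div m). cball x r)"
    "(\<Union>k<N. P k) \<subseteq> (\<Union>t<N * m. F t)"
  using assms unfolding refinement_def by blast+

lemma refinement_trans:
  assumes F: "refinement r N P m F" and G: "refinement r' (N * m) F m' G"
  shows "refinement (r + r') N P (m' * m) G"
proof -
  have "G t \<subseteq> (\<Union>x\<in>P (t div (m' * m)). cball x (r + r'))" if t: "t < N * m * m'" for t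
  proof
    fix y assume "y \<in> G t"
    then obtain x where x: "x \<in> F (t div m')" "dist x y \<le> r'" using refinementD(3)[OF G t] by auto
    have "t div m' < N * m" using t by (rule less_mult_imp_div_less)
    then obtain z where z: "z \<in> P (t div m' div m)" "dist z x \<le> r" using refinementD(3)[OF F] x by fastforce
    have "dist z y \<le> r + r'" using dist_triangle[of z y x] x z by linarith
    then show "y \<in> (\<Union>x\<in>P (t div (m' * m)). cball x (r + r'))" using z by (auto simp: div_mult2_eq)
  qed
  moreover have "N * (m' * m) = N * m * m'" by simp
  moreover have "(\<Union>k<N. P k) \<subseteq> (\<Union>t<N * m * m'. G t)"
    using refinementD(4)[OF F] refinementD(4)[OF G] by (rule subset_trans)
  moreover have "m' * m > 0" using refinementD(1)[OF F] refinementD(1)[OF G] by simp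
  ultimately show ?thesis using refinementD(2)[OF G] by (simp only: refinement_def) blast
qed

lemma refinement_mono:
  assumes "refinement r N P m F" "r \<le> r'"
  shows "refinement r' N P m F"
proof -
  have "(\<Union>x\<in>A. cball x r) \<subseteq> (\<Union>x\<in>A. cball x r')" for A :: "'a set"
    using assms(2) by (intro UN_mono subset_cball) auto
  then show ?thesis using assms(1) unfolding refinement_def by blast
qed

text \<open>The chain is bulged, slowed down, swept by strips orthogonal to \<open>b\<close>, and
  the empty cells are filled. The slowness \<open>e\<close> equals the spacing of the strips, so
  each symmetric difference fits into two adjacent strips.\<close>

lemma thin_refinement:
  fixes P :: "nat \<Rightarrow> 'a::euclidean_space set"
  assumes P: "cell_chain N P" and r: "r > 0" and e: "e > 0" and b: "norm b \<le> 1"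
  shows "\<exists>m F. refinement r N P m F \<and> (\<forall>t<N * m. \<forall>x\<in>F t. \<forall>y\<in>F t. \<bar>x \<bullet> b - y \<bullet> b\<bar> \<le> 4 * e)"
proof -
  have N: "N > 0" and ch: "convex_chain N P" and cP: "\<And>k. k < N \<Longrightarrow> compact (P k) \<and> P k \<noteq> {}"
    using P by (auto simp: cell_chain_def)
  obtain B R E M where R: "R > 0" and B: "convex_chain N B" "expansions N B E"
    and Bk: "\<forall>k<N. compact (B k) \<and> P k \<subseteq> B k \<and> B k \<subseteq> (\<Union>x\<in>P k. cball x r) \<and> B k \<subseteq> cball 0 R"
    and E: "\<forall>i j m. i \<le> j \<and> j < N \<longrightarrow> closed (E (run B i j) m) \<and> (E (run B i j) m, E (run B i j) (Suc m)) \<in> small_step e"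
    and M: "\<forall>i j. i \<le> j \<and> j < N \<longrightarrow> cball 0 R \<subseteq> E (run B i j) M"
    using bulged_expansions[OF ch cP r e] by metis
  obtain L C where L: "L > 0" and C: "convex_chain (N * L) C"
    and cells: "\<And>q. q < N * L \<Longrightarrow> compact (C q) \<and> C q \<noteq> {} \<and> C q \<subseteq> B (q div L)"
    and onto: "\<And>k. k < N \<Longrightarrow> \<exists>q<N * L. C q = B k"
    and step: "\<And>q. Suc q < N * L \<Longrightarrow> C (Suc q) \<subseteq> B (q div L)
        \<and> (\<forall>x\<in>(C q - C (Suc q)) \<union> (C (Suc q) - C q). \<forall>y\<in>(C q - C (Suc q)) \<union> (C (Suc q) - C q). dist x y \<le> e)"
  proof -
    have "\<exists>L>0. \<exists>C. convex_chain (N * L) C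
      \<and> (\<forall>q<N * L. compact (C q) \<and> C q \<noteq> {} \<and> C q \<subseteq> B (q div L))
      \<and> (\<forall>k<N. \<exists>q<N * L. C q = B k)
      \<and> (\<forall>q. Suc q < N * L \<longrightarrow> C (Suc q) \<subseteq> B (q div L)
          \<and> (\<forall>x\<in>(C q - C (Suc q)) \<union> (C (Suc q) - C q). \<forall>y\<in>(C q - C (Suc q)) \<union> (C (Suc q) - C q). dist x y \<le> e))"
    proof (rule slow_chain[OF B(1) _ B(2), where M = M])
      show "compact (B k) \<and> B k \<noteq> {}" if "k < N" for k
      proof -
        have "P k \<subseteq> B k" "compact (B k)" using Bk that by auto
        then show ?thesis using cP[OF that] by auto
      qed
      show "closed (E (run B i j) m)" if "i \<le> j" "j < N" for i j m using E that by blast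
      show "dist x y \<le> e" if "i \<le> j" "j < N" "x \<in> E (run B i j) (Suc m) - E (run B i j) m"
        "y \<in> E (run B i j) (Suc m) - E (run B i j) m" for i j m x y
      proof -
        have "(E (run B i j) m, E (run B i j) (Suc m)) \<in> small_step e" using E that(1,2) by blast
        then show ?thesis using that(3,4) unfolding small_step_def by blast
      qed
      show "B k \<subseteq> E (run B i j) M" if "i \<le> j" "j < N" "k < N" for i j k
      proof -
        have "B k \<subseteq> cball 0 R" "cball 0 R \<subseteq> E (run B i j) M" using Bk M that by auto
        then show ?thesis by (rule subset_trans)
      qed
    qed
    then show ?thesis using that by blast
  qed
  define Q where "Q = N * L"
  \<comment> \<open>The value \<open>x \<bullet> b + R\<close> lies between 0 and
    \<open>2 * R\<close>, so the strip number \<open>s\<close> is at most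
    \<open>\<lfloor>2 * R / e\<rfloor>\<close>; the summand 2 leaves room for
    \<open>Suc s < K\<close>.\<close>
  define K where "K = nat \<lfloor>2 * R / e\<rfloor> + 2"
  define J where "J s = {x. \<bar>x \<bullet> b + R - real s * e\<bar> \<le> 2 * e}" for s
  have CR: "norm x \<le> R" if "q < Q" "x \<in> C q" for q x
  proof -
    have "q div L < N" using that(1) less_mult_imp_div_less unfolding Q_def by blast
    then have "B (q div L) \<subseteq> cball 0 R" using Bk by blast
    then show ?thesis using that cells[of q] unfolding Q_def by auto
  qed
  \<comment> \<open>With \<open>s\<close> the integer part of
    \<open>(x \<bullet> b + R) / e\<close>, all points within \<open>e\<close> of \<open>x\<close>
    differ by at most \<open>2 * e\<close> from the centres of the strips \<open>s\<close> and
    \<open>s + 1\<close>. This determines the half-width of \<open>J\<close>.\<close>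
  have strip: "\<exists>s. Suc s < K \<and> (\<forall>y. dist x y \<le> e \<longrightarrow> y \<in> J s \<and> y \<in> J (Suc s))" if "norm x \<le> R" for x
  proof -
    let ?z = "x \<bullet> b + R"
    define s where "s = nat \<lfloor>?z / e\<rfloor>"
    have "\<bar>x \<bullet> b\<bar> \<le> norm x * norm b" by (rule Cauchy_Schwarz_ineq2)
    also have "\<dots> \<le> R * 1" using that b R by (intro mult_mono) auto
    finally have z: "0 \<le> ?z" "?z \<le> 2 * R" by auto
    have s0: "real s = of_int \<lfloor>?z / e\<rfloor>" using z e by (simp add: s_def)
    have "real s \<le> ?z / e" "?z / e < real s + 1" unfolding s0 by linarith+
    then have s: "real s * e \<le> ?z" "?z < real s * e + e" using e by (auto simp: field_simps)
    have "?z / e \<le> 2 * R / e" using z e by (intro divide_right_mono) auto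
    then have "s \<le> nat \<lfloor>2 * R / e\<rfloor>" unfolding s_def by (intro nat_mono floor_mono)
    then have "Suc s < K" by (simp add: K_def)
    moreover have "y \<in> J s \<and> y \<in> J (Suc s)" if "dist x y \<le> e" for y
    proof -
      have "\<bar>(x - y) \<bullet> b\<bar> \<le> norm (x - y) * norm b" by (rule Cauchy_Schwarz_ineq2)
      also have "\<dots> \<le> e * 1" using that b e by (intro mult_mono) (auto simp: dist_norm)
      finally have "\<bar>x \<bullet> b - y \<bullet> b\<bar> \<le> e" by (simp add: inner_diff_left)
      then show ?thesis using s by (auto simp: J_def abs_le_iff algebra_simps)
    qed
    ultimately show ?thesis by blast
  qed
  have "\<exists>s. Suc s < K \<and> C (Suc q) - C q \<subseteq> J s \<and> C q - C (Suc q) \<subseteq> J (Suc s)" if q: "Suc q < Q" for q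
  proof (cases "(C q - C (Suc q)) \<union> (C (Suc q) - C q) = {}")
    case True then show ?thesis by (intro exI[of _ 0]) (auto simp: K_def)
  next
    case False
    then obtain x where x: "x \<in> (C q - C (Suc q)) \<union> (C (Suc q) - C q)" by blast
    then have "norm x \<le> R" using CR[of q x] CR[of "Suc q" x] q by auto
    then obtain s where s: "Suc s < K" "\<forall>y. dist x y \<le> e \<longrightarrow> y \<in> J s \<and> y \<in> J (Suc s)"
      using strip by blast
    have "dist x y \<le> e" if "y \<in> (C q - C (Suc q)) \<union> (C (Suc q) - C q)" for y
      using step[of q] q x that unfolding Q_def by blast
    then show ?thesis using s by blast
  qed
  then obtain s where s: "\<And>q. Suc q < Q \<Longrightarrow>
      Suc (s q) < K \<and> C (Suc q) - C q \<subseteq> J (s q) \<and> C q - C (Suc q) \<subseteq> J (Suc (s q))"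
    by metis
  have K: "K > 0" by (simp add: K_def)
  obtain \<sigma> \<phi> where G: "convex_chain (Q * (2 * K)) (\<lambda>t. C (\<sigma> t) \<inter> J (\<phi> t))"
    and \<sigma>: "\<And>t. t < Q * (2 * K) \<Longrightarrow> \<sigma> t = t div (2 * K) \<or> \<sigma> t = Suc (t div (2 * K)) \<and> \<sigma> t < Q"
    and up: "\<And>q i. i < K \<Longrightarrow> \<sigma> (q * (2 * K) + i) = q \<and> \<phi> (q * (2 * K) + i) = i"
    using strip_walk[of Q C K e J b R s, OF _ K e J_def s] C unfolding Q_def by blast
  define G where "G t = C (\<sigma> t) \<inter> J (\<phi> t)" for t
  \<comment> \<open>On the way up all strips are combined with the same cell \<open>C q\<close>, so
    all of it is caught. Thus no point is lost and no block consists of empty cells only.\<close>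
  have hit: "\<exists>t<Q * (2 * K). t div (2 * K) = q \<and> x \<in> G t" if "q < Q" "x \<in> C q" for q x
  proof -
    from strip[OF CR[OF that]]
    obtain i where i: "Suc i < K" "\<forall>y. dist x y \<le> e \<longrightarrow> y \<in> J i \<and> y \<in> J (Suc i)"
      by blast
    then have "x \<in> J i" using e by simp
    moreover have "\<sigma> (q * (2 * K) + i) = q" "\<phi> (q * (2 * K) + i) = i" using up[of i q] i by auto
    moreover have "q * (2 * K) + i < Suc q * (2 * K)" using i by simp
    then have "q * (2 * K) + i < Q * (2 * K)" using that(1) by (meson Suc_leI less_le_trans mult_le_mono1)
    moreover have "(q * (2 * K) + i) div (2 * K) = q" using i by (simp add: div_add1_eq)
    ultimately show ?thesis using that(2) by (auto simp: G_def)
  qed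
  have "\<exists>t. t div (2 * K) = q \<and> G t \<noteq> {}" if "q < Q" for q
    using hit[OF that] cells[of q] that unfolding Q_def by blast
  moreover have "convex_chain (Q * (2 * K)) G" using G unfolding G_def .
  moreover have "2 * K > 0" using K by simp
  ultimately have "\<exists>\<pi>. convex_chain (Q * (2 * K)) (\<lambda>t. G (\<pi> t)) \<and> (\<forall>t. G t \<noteq> {} \<longrightarrow> \<pi> t = t)
      \<and> (\<forall>t<Q * (2 * K). \<pi> t div (2 * K) = t div (2 * K) \<and> G (\<pi> t) \<noteq> {})"
    by (intro convex_chain_fill)
  then obtain \<pi> where \<pi>: "convex_chain (Q * (2 * K)) (\<lambda>t. G (\<pi> t))" "\<And>t. G t \<noteq> {} \<Longrightarrow> \<pi> t = t"
    "\<And>t. t < Q * (2 * K) \<Longrightarrow> \<pi> t div (2 * K) = t div (2 * K) \<and> G (\<pi> t) \<noteq> {}"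
    by blast
  define F where "F t = G (\<pi> t)" for t
  define m where "m = 2 * K * L"
  have Nm: "N * m = Q * (2 * K)" by (simp add: m_def Q_def)
  have Fin: "compact (F t) \<and> F t \<noteq> {} \<and> F t \<subseteq> B (t div m)" if t: "t < Q * (2 * K)" for t
  proof -
    have pt: "\<pi> t div (2 * K) = t div (2 * K)" "G (\<pi> t) \<noteq> {}" using \<pi>(3)[OF t] by auto
    have q: "t div (2 * K) < Q" using t by (rule less_mult_imp_div_less)
    have pi_lt: "\<pi> t < Q * (2 * K)" using q K unfolding pt(1)[symmetric] by (simp add: div_less_iff_less_mult)
    \<comment> \<open>The sweep may already be one cell ahead; by \<open>step\<close> that cell
      still lies in the member of the current block.\<close>
    have sq: "\<sigma> (\<pi> t) < Q \<and> C (\<sigma> (\<pi> t)) \<subseteq> B (t div (2 * K) div L)"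
      using \<sigma>[OF pi_lt] cells[of "t div (2 * K)"] step[of "t div (2 * K)"] q unfolding pt(1) Q_def by auto
    have "closed (J i)" for i unfolding J_def by (intro closed_Collect_le continuous_intros)
    moreover have "compact (C (\<sigma> (\<pi> t)))" using cells sq unfolding Q_def by blast
    ultimately have "compact (F t)" unfolding F_def G_def by (intro compact_Int_closed)
    then show ?thesis using pt sq unfolding F_def G_def m_def div_mult2_eq by blast
  qed
  have width: "\<bar>x \<bullet> b - y \<bullet> b\<bar> \<le> 4 * e" if "x \<in> F t" "y \<in> F t" for t x y
    using that by (auto simp: F_def G_def J_def)
  have "(\<Union>k<N. P k) \<subseteq> (\<Union>t<N * m. F t)"
  proof
    fix x assume "x \<in> (\<Union>k<N. P k)"
    then obtain k where k: "k < N" "x \<in> P k" by blast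
    then have "x \<in> B k" using Bk by blast
    then obtain q where "q < Q" "x \<in> C q" using onto[OF k(1)] unfolding Q_def by blast
    then obtain t where "t < Q * (2 * K)" "x \<in> G t" using hit by blast
    moreover then have "\<pi> t = t" by (intro \<pi>(2)) blast
    then have "F t = G t" unfolding F_def by simp
    ultimately show "x \<in> (\<Union>t<N * m. F t)" unfolding Nm by blast
  qed
  moreover have "F t \<subseteq> (\<Union>x\<in>P (t div m). cball x r)" if "t < N * m" for t
  proof -
    have "t div m < N" using that by (rule less_mult_imp_div_less)
    then have "B (t div m) \<subseteq> (\<Union>x\<in>P (t div m). cball x r)" using Bk by blast
    then show ?thesis using Fin that unfolding Nm by blast
  qed
  moreover have "m > 0" using K L by (simp add: m_def)
  moreover have "cell_chain (N * m) F"
    using N \<open>m > 0\<close> \<pi>(1) Fin unfolding cell_chain_def Nm[symmetric] F_def[symmetric] by simp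
  ultimately have "refinement r N P m F" unfolding refinement_def by blast
  then show ?thesis using width by blast
qed

text \<open>The cells are made thin in one coordinate direction after another. A later bulging by
  \<open>r'\<close> adds at most \<open>2 * r'\<close> to the widths achieved before.\<close>

lemma small_refinement:
  fixes P :: "nat \<Rightarrow> 'a::euclidean_space set"
  assumes P: "cell_chain N P" and r: "r > 0" and e: "e > 0"
  shows "\<exists>m F. refinement r N P m F \<and> (\<forall>t<N * m. \<forall>x\<in>F t. \<forall>y\<in>F t. dist x y \<le> e)"
proof -
  have thin: "\<exists>m F. refinement r N P m F \<and> (\<forall>t<N * m. \<forall>x\<in>F t. \<forall>y\<in>F t. \<forall>b\<in>D. \<bar>x \<bullet> b - y \<bullet> b\<bar> \<le> d)"
    if "finite D" "D \<subseteq> Basis" "r > 0" "d > 0" for D r d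
    using that
  proof (induction D arbitrary: r d)
    case empty
    have "P t \<subseteq> (\<Union>x\<in>P t. cball x r)" for t using empty by auto
    then have "refinement r N P 1 P" using P by (simp add: refinement_def)
    then show ?case by blast
  next
    case (insert b D)
    obtain m F where F: "refinement (r/2) N P m F"
      and wF: "\<And>t x y c. t < N * m \<Longrightarrow> x \<in> F t \<Longrightarrow> y \<in> F t \<Longrightarrow> c \<in> D \<Longrightarrow> \<bar>x \<bullet> c - y \<bullet> c\<bar> \<le> d/2"
      using insert.IH[of "r/2" "d/2"] insert.prems by auto
    \<comment> \<open>The inherited width \<open>d/2\<close> and twice \<open>d/4\<close> give
      \<open>d\<close>; the bound \<open>r/2\<close> keeps the total displacement within
      \<open>r\<close>.\<close>
    define r' where "r' = min (r/2) (d/4)"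
    have r': "r' > 0" "r/2 + r' \<le> r" "r' \<le> d/4" using insert.prems by (auto simp: r'_def)
    have "norm b \<le> 1" "d / 4 > 0" using insert.prems by auto
    then obtain m' G where G: "refinement r' (N * m) F m' G"
      and wG: "\<And>t x y. t < N * m * m' \<Longrightarrow> x \<in> G t \<Longrightarrow> y \<in> G t \<Longrightarrow> \<bar>x \<bullet> b - y \<bullet> b\<bar> \<le> 4 * (d/4)"
      using thin_refinement[OF refinementD(2)[OF F] r'(1), of "d/4" b] by metis
    have "\<bar>x \<bullet> c - y \<bullet> c\<bar> \<le> d" if t: "t < N * m * m'" and xy: "x \<in> G t" "y \<in> G t" and c: "c \<in> insert b D" for t x y c
    proof (cases "c = b")
      case True then show ?thesis using wG[OF t xy] by simp
    next
      case False
      have "x \<in> (\<Union>z\<in>F (t div m'). cball z r')" "y \<in> (\<Union>z\<in>F (t div m'). cball z r')"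
        using refinementD(3)[OF G t] xy by blast+
      then obtain x' y' where x': "x' \<in> F (t div m')" "dist x' x \<le> r'" and y': "y' \<in> F (t div m')" "dist y' y \<le> r'"
        unfolding UN_iff mem_cball by blast
      have nc: "norm c = 1" using c insert.prems by auto
      have "\<bar>u \<bullet> c - v \<bullet> c\<bar> \<le> dist u v" for u v
        using Cauchy_Schwarz_ineq2[of "u - v" c] nc by (simp add: inner_diff_left dist_norm)
      from this[of x' x] this[of y' y]
      have "\<bar>x' \<bullet> c - x \<bullet> c\<bar> \<le> r'" "\<bar>y' \<bullet> c - y \<bullet> c\<bar> \<le> r'" using x' y' by linarith+
      moreover have "t div m' < N * m" using t by (rule less_mult_imp_div_less)
      then have "\<bar>x' \<bullet> c - y' \<bullet> c\<bar> \<le> d/2" using wF[OF _ x'(1) y'(1)] c False by blast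
      ultimately show ?thesis using r'(3) by linarith
    qed
    moreover have "refinement r N P (m' * m) G" using refinement_mono[OF refinement_trans[OF F G] r'(2)] .
    moreover have "N * (m' * m) = N * m * m'" by simp
    ultimately show ?case by metis
  qed
  obtain m F where F: "refinement r N P m F"
    and w: "\<And>t x y b. t < N * m \<Longrightarrow> x \<in> F t \<Longrightarrow> y \<in> F t \<Longrightarrow> b \<in> Basis \<Longrightarrow> \<bar>x \<bullet> b - y \<bullet> b\<bar> \<le> e / real DIM('a)"
    using thin[of Basis r "e / real DIM('a)"] r e by auto
  have "dist x y \<le> e" if "t < N * m" "x \<in> F t" "y \<in> F t" for t x y
  proof -
    have "dist x y \<le> (\<Sum>b\<in>Basis. \<bar>(x - y) \<bullet> b\<bar>)" unfolding dist_norm by (rule norm_le_l1)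
    also have "\<dots> \<le> (\<Sum>b\<in>(Basis::'a set). e / real DIM('a))"
      using w[OF that] by (intro sum_mono) (simp add: inner_diff_left)
    also have "\<dots> = e" by simp
    finally show ?thesis .
  qed
  then show ?thesis using F by blast
qed

subsection \<open>The limit curve\<close>

text \<open>The unit interval is divided into \<open>N\<close> equal pieces; the minimum assigns the
  end point 1 to the last of them.\<close>

definition cell_index :: "nat \<Rightarrow> real \<Rightarrow> nat" where
  "cell_index N t = min (nat \<lfloor>t * real N\<rfloor>) (N - 1)"

lemma cell_index_less: "N > 0 \<Longrightarrow> cell_index N t < N"
  by (auto simp: cell_index_def)

lemma cell_index_mono: "s \<le> t \<Longrightarrow> cell_index N s \<le> cell_index N t"
  unfolding cell_index_def by (intro min.mono nat_mono floor_mono mult_right_mono) auto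

text \<open>The pieces for a refined chain subdivide those for the coarse one, so the cells of all
  levels at one parameter can be compared.\<close>

lemma cell_index_div:
  assumes "N > 0" "m > 0" "t \<ge> 0"
  shows "cell_index (N * m) t div m = cell_index N t"
proof -
  have "t * real (N * m) / real_of_int (int m) = t * real N" using assms by simp
  then have "\<lfloor>t * real N\<rfloor> = \<lfloor>t * real (N * m)\<rfloor> div int m"
    using floor_divide_real_eq_div[of "int m" "t * real (N * m)"] by simp
  then have 1: "nat \<lfloor>t * real (N * m)\<rfloor> div m = nat \<lfloor>t * real N\<rfloor>"
    using assms by (simp add: nat_div_distrib)
  have 2: "(N * m - 1) div m = N - 1"
  proof -
    obtain n where n: "N = Suc n" using assms(1) gr0_implies_Suc by blast
    have "N * m - 1 = (m - 1) + n * m" using assms(2) unfolding n by simp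
    moreover have "((m - 1) + n * m) div m = n + (m - 1) div m" using assms(2) by (intro div_mult_self1) simp
    moreover have "(m - 1) div m = 0" using assms(2) by (intro div_less) simp
    ultimately show ?thesis unfolding n by simp
  qed
  have "min a b div m = min (a div m) (b div m)" for a b :: nat
    using div_le_mono[of a b m] div_le_mono[of b a m] by (auto simp: min_def)
  then show ?thesis unfolding cell_index_def using 1 2 by simp
qed

lemma cell_index_of_quotient: "k < N \<Longrightarrow> cell_index N (real k / real N) = k"
  by (auto simp: cell_index_def)

lemma cell_index_onto:
  assumes "N > 0" "u \<le> v" "cell_index N u \<le> k" "k \<le> cell_index N v"
  shows "\<exists>t\<in>{u..v}. cell_index N t = k"
proof -
  consider "k = cell_index N u" | "k = cell_index N v" | "cell_index N u < k" "k < cell_index N v"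
    using assms by linarith
  then show ?thesis
  proof cases
    case 3
    let ?t = "real k / real N"
    have "k < N" using 3 cell_index_less[OF assms(1), of v] by simp
    then have "cell_index N ?t = k" by (rule cell_index_of_quotient)
    moreover have "u \<le> ?t" using cell_index_mono[of ?t u N] 3 calculation by linarith
    moreover have "?t \<le> v" using cell_index_mono[of v ?t N] 3 calculation by linarith
    ultimately show ?thesis by auto
  qed (use assms in auto)
qed

lemma cell_index_close:
  assumes "N > 0" "u \<le> v" "v < u + 1 / real N"
  shows "cell_index N v \<le> Suc (cell_index N u)"
proof -
  have "v * real N < u * real N + 1" using assms by (simp add: field_simps)
  then have "\<lfloor>v * real N\<rfloor> \<le> \<lfloor>u * real N\<rfloor> + 1" by linarith
  then have "nat \<lfloor>v * real N\<rfloor> \<le> Suc (nat \<lfloor>u * real N\<rfloor>)" by linarith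
  then show ?thesis by (auto simp: cell_index_def)
qed

lemma refinement_sequence:
  fixes T :: "'a::euclidean_space set"
  assumes T: "T \<noteq> {}" "compact T" "convex T"
  shows "\<exists>N F m. \<forall>n. cell_chain (N n) (F n) \<and> N (Suc n) = N n * m n
    \<and> refinement ((1/2) ^ n) (N n) (F n) (m n) (F (Suc n))
    \<and> (\<forall>t<N n. \<forall>x\<in>F n t. \<forall>y\<in>F n t. dist x y \<le> (1/2) ^ n) \<and> T \<subseteq> (\<Union>t<N n. F n t)"
proof -
  define P :: "nat \<Rightarrow> nat \<times> (nat \<Rightarrow> 'a set) \<Rightarrow> bool" where
    "P n s \<longleftrightarrow> cell_chain (fst s) (snd s) \<and> T \<subseteq> (\<Union>t<fst s. snd s t)
      \<and> (\<forall>t<fst s. \<forall>x\<in>snd s t. \<forall>y\<in>snd s t. dist x y \<le> (1/2) ^ n)" for n s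
  define Q :: "nat \<Rightarrow> nat \<times> (nat \<Rightarrow> 'a set) \<Rightarrow> nat \<times> (nat \<Rightarrow> 'a set) \<Rightarrow> bool" where
    "Q n s s' \<longleftrightarrow> (\<exists>m. fst s' = fst s * m \<and> refinement ((1/2) ^ n) (fst s) (snd s) m (snd s'))" for n s s'
  have extend: "\<exists>s'. P k s' \<and> Q n s s'" if s: "cell_chain (fst s) (snd s)" "T \<subseteq> (\<Union>t<fst s. snd s t)" for n k s
  proof -
    obtain m F where F: "refinement ((1/2) ^ n) (fst s) (snd s) m F"
      "\<forall>t<fst s * m. \<forall>x\<in>F t. \<forall>y\<in>F t. dist x y \<le> (1/2) ^ k"
      using small_refinement[OF s(1), of "(1/2) ^ n" "(1/2) ^ k"] by auto
    then have "P k (fst s * m, F)" using refinementD(2,4)[OF F(1)] s(2) by (auto simp: P_def)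
    moreover have "Q n s (fst s * m, F)" using F by (auto simp: Q_def)
    ultimately show ?thesis by blast
  qed
  \<comment> \<open>The chain consisting of \<open>T\<close> alone may have diameter above 1, so it
    is refined once to obtain level 0.\<close>
  have "cell_chain 1 (\<lambda>_. T)" using T by (simp add: cell_chain_def convex_chain_def run_def)
  moreover have "T \<subseteq> (\<Union>t<(1::nat). T)" by auto
  ultimately have "\<exists>s. P 0 s" using extend[of "(1, \<lambda>_. T)" 0 0] unfolding fst_conv snd_conv by blast
  moreover have "\<exists>s'. P (Suc n) s' \<and> Q n s s'" if "P n s" for n s
    using extend[of s "Suc n" n] that by (auto simp: P_def)
  ultimately obtain f where f: "\<forall>n. P n (f n) \<and> Q n (f n) (f (Suc n))"
    using dependent_nat_choice[of P Q] by blast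
  then have "\<forall>n. \<exists>m. fst (f (Suc n)) = fst (f n) * m \<and> refinement ((1/2) ^ n) (fst (f n)) (snd (f n)) m (snd (f (Suc n)))"
    unfolding Q_def by blast
  then obtain m where "\<forall>n. fst (f (Suc n)) = fst (f n) * m n
      \<and> refinement ((1/2) ^ n) (fst (f n)) (snd (f n)) (m n) (snd (f (Suc n)))"
    by metis
  then show ?thesis using f unfolding P_def
    by (intro exI[of _ "\<lambda>n. fst (f n)"] exI[of _ "\<lambda>n. snd (f n)"] exI[of _ m]) blast
qed

text \<open>A point is chosen in the cell of every level. Choices at consecutive levels differ by at
  most a diameter plus the slack, so they converge uniformly, and the cell of level \<open>n\<close>
  lies within \<open>5 * (1/2) ^ n\<close> of the limit. Covering and convexity pass from the chains
  to the curve up to such errors, which disappear because images of closed intervals are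
  closed.\<close>

lemma convex_curve_covering:
  fixes T :: "'a::euclidean_space set"
  assumes T: "T \<noteq> {}" "compact T" "convex T"
  shows "\<exists>g::real \<Rightarrow> 'a. continuous_on {0..1} g \<and> T \<subseteq> g ` {0..1}
    \<and> (\<forall>u v. 0 \<le> u \<and> u \<le> v \<and> v \<le> 1 \<longrightarrow> convex (g ` {u..v}))"
proof -
  obtain N F m where NF: "\<forall>n. cell_chain (N n) (F n) \<and> N (Suc n) = N n * m n
    \<and> refinement ((1/2) ^ n) (N n) (F n) (m n) (F (Suc n))
    \<and> (\<forall>t<N n. \<forall>x\<in>F n t. \<forall>y\<in>F n t. dist x y \<le> (1/2) ^ n) \<and> T \<subseteq> (\<Union>t<N n. F n t)"
    using refinement_sequence[OF T] by blast
  have N: "N n > 0" "convex_chain (N n) (F n)" and cF: "k < N n \<Longrightarrow> compact (F n k) \<and> F n k \<noteq> {}" for n k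
    using NF unfolding cell_chain_def by blast+
  have diam: "dist x y \<le> (1/2) ^ n" if "k < N n" "x \<in> F n k" "y \<in> F n k" for n k x y
    using NF that by blast
  have ref: "refinement ((1/2) ^ n) (N n) (F n) (m n) (F (Suc n))" "N (Suc n) = N n * m n" for n
    using NF by blast+
  define ix where "ix n t = cell_index (N n) t" for n t
  have ix: "ix n t < N n" for n t unfolding ix_def using N(1) by (rule cell_index_less)
  define p where "p n t = (SOME x. x \<in> F n (ix n t))" for n t
  have p: "p n t \<in> F n (ix n t)" for n t
    unfolding p_def using cF[OF ix] by (simp add: some_in_eq)
  have near: "dist (p n t) (p (Suc n) t) \<le> 2 * (1/2) ^ n" if "t \<ge> 0" for n t
  proof -
    have "ix (Suc n) t div m n = ix n t"
      unfolding ix_def ref(2) using N(1) refinementD(1)[OF ref(1)] that by (rule cell_index_div)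
    moreover have "ix (Suc n) t < N n * m n" using ix[of "Suc n" t] ref(2) by simp
    ultimately have "F (Suc n) (ix (Suc n) t) \<subseteq> (\<Union>x\<in>F n (ix n t). cball x ((1/2) ^ n))"
      using refinementD(3)[OF ref(1)[of n], of "ix (Suc n) t"] by simp
    then have "p (Suc n) t \<in> (\<Union>x\<in>F n (ix n t). cball x ((1/2) ^ n))" using p[of "Suc n" t] by (rule subsetD)
    then obtain x where x: "x \<in> F n (ix n t)" "dist x (p (Suc n) t) \<le> (1/2) ^ n" by auto
    then show ?thesis using diam[OF ix p x(1)] dist_triangle[of "p n t" "p (Suc n) t" x] by linarith
  qed
  \<comment> \<open>The right-hand side is the exact geometric sum of the bounds in
    \<open>near\<close>.\<close>
  have tele: "dist (p n t) (p (n + k) t) \<le> 4 * (1/2) ^ n - 4 * (1/2) ^ (n + k)" if "t \<ge> 0" for n k t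
  proof (induction k)
    case (Suc k)
    then show ?case
      using near[OF that, of "n + k"] dist_triangle[of "p n t" "p (Suc (n + k)) t" "p (n + k) t"] by simp
  qed simp
  have bd: "dist (p n t) (p (n + k) t) \<le> 4 * (1/2) ^ n" if "t \<ge> 0" for n k t
    using tele[OF that, of n k] zero_le_power[of "1/2::real" "n + k"] by linarith
  have tiny: "\<exists>n. c * (1/2) ^ n < (d::real)" if "d > 0" "c > 0" for c d
  proof -
    have "d / c > 0" using that by simp
    then obtain n where "(1/2::real) ^ n < d / c" using real_arch_pow_inv[of "d / c" "1/2"] by auto
    then show ?thesis using \<open>c > 0\<close> by (intro exI[of _ n]) (simp add: pos_less_divide_eq mult.commute)
  qed
  have "\<exists>l. (\<lambda>n. p n t) \<longlonglongrightarrow> l" if "t \<ge> 0" for t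
  proof -
    have "Cauchy (\<lambda>n. p n t)"
    proof (rule metric_CauchyI)
      fix d :: real assume "d > 0"
      then obtain n where n: "8 * (1/2) ^ n < d" using tiny[of d 8] by auto
      have "dist (p i t) (p j t) < d" if "i \<ge> n" "j \<ge> n" for i j
        using bd[OF \<open>t \<ge> 0\<close>, of n "i - n"] bd[OF \<open>t \<ge> 0\<close>, of n "j - n"] that n
          dist_triangle3[of "p i t" "p j t" "p n t"] by simp
      then show "\<exists>M. \<forall>i\<ge>M. \<forall>j\<ge>M. dist (p i t) (p j t) < d" by blast
    qed
    then show ?thesis by (simp add: Cauchy_convergent_iff convergent_def)
  qed
  then obtain g where g: "\<And>t. t \<ge> 0 \<Longrightarrow> (\<lambda>n. p n t) \<longlonglongrightarrow> g t" by metis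
  have pg: "dist (p n t) (g t) \<le> 4 * (1/2) ^ n" if "t \<ge> 0" for n t
  proof (rule LIMSEQ_le_const2[OF tendsto_dist[OF tendsto_const g[OF that]]])
    have "dist (p n t) (p k t) \<le> 4 * (1/2) ^ n" if "k \<ge> n" for k
      using bd[OF \<open>t \<ge> 0\<close>, of n "k - n"] that by simp
    then show "\<exists>M. \<forall>k\<ge>M. dist (p n t) (p k t) \<le> 4 * (1/2) ^ n" by blast
  qed
  have cell: "dist x (g t) \<le> 5 * (1/2) ^ n" if "t \<ge> 0" "x \<in> F n (ix n t)" for n t x
    using pg[OF that(1), of n] diam[OF ix that(2) p] dist_triangle[of x "g t" "p n t"] by linarith
  \<comment> \<open>Parameters this close have equal or adjacent cells, and adjacent cells share a
    point; each side contributes 5.\<close>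
  have close: "dist (g u) (g v) \<le> 10 * (1/2) ^ n" if uv: "0 \<le> u" "u \<le> v" "v < u + 1 / real (N n)" for n u v
  proof -
    have le: "ix n u \<le> ix n v" "ix n v \<le> Suc (ix n u)"
      unfolding ix_def using uv N(1) by (auto intro: cell_index_mono cell_index_close)
    have "F n (ix n u) \<inter> F n (ix n v) \<noteq> {}"
    proof (cases "ix n v = ix n u")
      case True then show ?thesis using cF[OF ix] by simp
    next
      case False
      then have v: "ix n v = Suc (ix n u)" using le by simp
      show ?thesis
      proof (rule convex_Un_compact_meet)
        show "convex (F n (ix n u) \<union> F n (ix n v))"
          using convex_chainD[OF N(2), of "ix n u" "ix n v"] ix[of n v] v by (simp add: run_Suc_right)
      qed (use cF[OF ix] in auto)
    qed
    then obtain x where "x \<in> F n (ix n u)" "x \<in> F n (ix n v)" by blast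
    then show ?thesis using cell[of u x n] cell[of v x n] uv dist_triangle3[of "g u" "g v" x] by linarith
  qed
  have cont: "continuous_on {0..1} g"
    unfolding continuous_on_iff
  proof (intro ballI allI impI)
    fix u d :: real assume u: "u \<in> {0..1}" and d: "d > 0"
    obtain n where n: "10 * (1/2) ^ n < d" using tiny[OF d, of 10] by auto
    have "dist (g v) (g u) < d" if "v \<in> {0..1}" "dist v u < 1 / real (N n)" for v
    proof (cases "u \<le> v")
      case True
      then show ?thesis using close[of u v n] n u that by (simp add: dist_commute dist_real_def)
    next
      case False
      then show ?thesis using close[of v u n] n u that by (simp add: dist_commute dist_real_def)
    qed
    moreover have "1 / real (N n) > 0" using N(1) by simp
    ultimately show "\<exists>\<delta>>0. \<forall>v\<in>{0..1}. dist v u < \<delta> \<longrightarrow> dist (g v) (g u) < d" by blast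
  qed
  have closed_img: "closed (g ` {u..v})" if "0 \<le> u" "v \<le> 1" for u v
    by (intro compact_imp_closed compact_continuous_image continuous_on_subset[OF cont])
      (use that in auto)
  have "T \<subseteq> g ` {0..1}"
  proof
    fix x assume x: "x \<in> T"
    have "x \<in> closure (g ` {0..1})"
      unfolding closure_approachable
    proof (intro allI impI)
      fix d :: real assume "d > 0"
      then obtain n where n: "5 * (1/2) ^ n < d" using tiny[of d 5] by auto
      have "x \<in> (\<Union>t<N n. F n t)" using NF x by blast
      then obtain k where k: "k < N n" "x \<in> F n k" by blast
      let ?t = "real k / real (N n)"
      have "ix n ?t = k" unfolding ix_def using k(1) by (rule cell_index_of_quotient)
      then have "dist (g ?t) x < d" using cell[of ?t x n] k n by (simp add: dist_commute)
      moreover have "?t \<in> {0..1}" using k(1) by simp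
      ultimately show "\<exists>y\<in>g ` {0..1}. dist y x < d" by blast
    qed
    then show "x \<in> g ` {0..1}" using closed_img[of 0 1] by simp
  qed
  moreover have "convex (g ` {u..v})" if uv: "0 \<le> u" "u \<le> v" "v \<le> 1" for u v
  proof (rule convexI)
    fix x y and s t :: real
    assume "x \<in> g ` {u..v}" "y \<in> g ` {u..v}" and st: "0 \<le> s" "0 \<le> t" "s + t = 1"
    then obtain a b where ab: "a \<in> {u..v}" "b \<in> {u..v}" "x = g a" "y = g b" by blast
    let ?z = "s *\<^sub>R x + t *\<^sub>R y"
    have "?z \<in> closure (g ` {u..v})"
      unfolding closure_approachable
    proof (intro allI impI)
      fix d :: real assume "d > 0"
      then obtain n where n: "9 * (1/2) ^ n < d" using tiny[of d 9] by auto
      \<comment> \<open>The combination of the chosen points lies in a convex run, hence in a cell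
        whose index is attained at some parameter \<open>c\<close> between \<open>a\<close> and
        \<open>b\<close>. That cell contributes the error 5, the chosen points contribute 4.\<close>
      let ?w = "s *\<^sub>R p n a + t *\<^sub>R p n b"
      let ?lo = "min a b" and ?hi = "max a b"
      have lo: "ix n ?lo \<le> ix n a" "ix n a \<le> ix n ?hi" "ix n ?lo \<le> ix n b" "ix n b \<le> ix n ?hi" "ix n ?lo \<le> ix n ?hi"
        unfolding ix_def by (auto intro!: cell_index_mono)
      have "p n a \<in> run (F n) (ix n ?lo) (ix n ?hi)" "p n b \<in> run (F n) (ix n ?lo) (ix n ?hi)"
        using p[of n a] p[of n b] lo unfolding run_def by force+
      moreover have "convex (run (F n) (ix n ?lo) (ix n ?hi))" using N(2) lo(5) ix by (rule convex_chainD)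
      ultimately have "?w \<in> run (F n) (ix n ?lo) (ix n ?hi)" using st by (simp add: convex_def)
      then obtain k where k: "ix n ?lo \<le> k" "k \<le> ix n ?hi" "?w \<in> F n k" by (auto simp: run_def)
      obtain c where c: "c \<in> {?lo..?hi}" "ix n c = k"
        using cell_index_onto[OF N(1)[of n], of ?lo ?hi k] k unfolding ix_def by fastforce
      have c': "c \<in> {u..v}" "c \<ge> 0" using c(1) ab uv by auto
      have w: "dist ?w (g c) \<le> 5 * (1/2) ^ n" using cell[OF c'(2), of ?w n] k(3) c(2) by simp
      have a0: "a \<ge> 0" "b \<ge> 0" using ab uv by auto
      have "?w - ?z = s *\<^sub>R (p n a - g a) + t *\<^sub>R (p n b - g b)" using ab by (simp add: algebra_simps)
      then have "dist ?w ?z \<le> norm (s *\<^sub>R (p n a - g a)) + norm (t *\<^sub>R (p n b - g b))"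
        unfolding dist_norm by (simp only: norm_triangle_ineq)
      also have "\<dots> = s * dist (p n a) (g a) + t * dist (p n b) (g b)" using st by (simp add: dist_norm)
      also have "\<dots> \<le> s * (4 * (1/2) ^ n) + t * (4 * (1/2) ^ n)"
        using pg[OF a0(1)] pg[OF a0(2)] st by (intro add_mono mult_left_mono)
      also have "\<dots> = 4 * (1/2) ^ n" using st by (simp flip: distrib_right)
      finally have "dist (g c) ?z < d" using w n dist_triangle3[of "g c" ?z ?w] by linarith
      then show "\<exists>y\<in>g ` {u..v}. dist y ?z < d" using c'(1) by blast
    qed
    then show "?z \<in> g ` {u..v}" using closed_img[of u v] uv by simp
  qed
  ultimately show ?thesis using cont by blast
qed

subsection \<open>Restriction to a convex set\<close>

text \<open>If the parameter interval between two visits to \<open>T\<close> avoids \<open>T\<close>, then the image of that interval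
  meets \<open>T\<close> in a convex set of at most two points; hence the two visits are at the same point and the
  excursion can be replaced by a constant path.\<close>

lemma convex_curve_restrict:
  fixes g :: "real \<Rightarrow> 'a::euclidean_space"
  assumes cont: "continuous_on {0..1} g" and T: "closed T" "convex T" "T \<noteq> {}" "T \<subseteq> g ` {0..1}"
    and cvx: "\<And>u v. 0 \<le> u \<Longrightarrow> u \<le> v \<Longrightarrow> v \<le> 1 \<Longrightarrow> convex (g ` {u..v})"
  shows "\<exists>h::real \<Rightarrow> 'a. continuous_on {0..1} h \<and> h ` {0..1} = T
    \<and> (\<forall>u v. 0 \<le> u \<and> u \<le> v \<and> v \<le> 1 \<longrightarrow> convex (h ` {u..v}))"
proof -
  define E where "E = {0..1} \<inter> g -` T"
  have E: "closed E" unfolding E_def using cont T(1) by (intro continuous_closed_preimage) auto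
  have Ene: "E \<noteq> {}" using T(3,4) by (auto simp: E_def)
  have E01: "E \<subseteq> {0..1}" by (auto simp: E_def)
  have gap: "g a = g b" if ab: "a \<in> E" "b \<in> E" and no: "\<And>w. w \<in> E \<Longrightarrow> \<not> (min a b < w \<and> w < max a b)" for a b
  proof -
    let ?u = "min a b" and ?v = "max a b"
    have "convex (T \<inter> g ` {?u..?v})" using T(2) ab E01 by (intro convex_Int cvx) auto
    moreover have "g a \<in> T \<inter> g ` {?u..?v}" "g b \<in> T \<inter> g ` {?u..?v}" using ab by (auto simp: E_def)
    ultimately have "closed_segment (g a) (g b) \<subseteq> T \<inter> g ` {?u..?v}" by (rule closed_segment_subset[rotated -1])
    then have "midpoint (g a) (g b) \<in> T \<inter> g ` {?u..?v}" by (rule subsetD) (rule midpoint_in_closed_segment)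
    then obtain w where w: "w \<in> {?u..?v}" "g w = midpoint (g a) (g b)" "g w \<in> T" by auto
    then have "w \<in> E" using ab E01 by (auto simp: E_def)
    then have "w = a \<or> w = b" using no[of w] w(1) by (auto simp: min_def max_def split: if_splits)
    then show ?thesis using w(2) midpoint_eq_endpoint[of "g a" "g b"] by metis
  qed
  \<comment> \<open>A parameter outside \<open>E\<close> receives the value at a nearest visit. By
    \<open>gap\<close> the visits on both sides of an excursion give the same value; before the
    first and after the last visit the path is constant as well.\<close>
  define h where "h t = g (closest_point E t)" for t
  have h: "h t = g e" if e: "e \<in> E" and no: "\<And>w. w \<in> E \<Longrightarrow> \<not> (min t e < w \<and> w < max t e)" for t e
  proof -
    let ?r = "closest_point E t"
    have r: "?r \<in> E" "\<And>w. w \<in> E \<Longrightarrow> \<bar>t - ?r\<bar> \<le> \<bar>t - w\<bar>"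
      using closest_point_exists[OF E Ene, of t] by (auto simp: dist_real_def)
    have "g ?r = g e"
    proof (rule gap[OF r(1) e])
      fix w assume w: "w \<in> E"
      show "\<not> (min ?r e < w \<and> w < max ?r e)" using no[OF w] r(2)[OF w] by (auto simp: min_def max_def split: if_splits)
    qed
    then show ?thesis by (simp add: h_def)
  qed
  have near: "\<exists>e\<in>E \<inter> {u..v}. h t = g e" if "E \<inter> {u..v} \<noteq> {}" "t \<in> {u..v}" for u v t
  proof -
    let ?e = "closest_point (E \<inter> {u..v}) t"
    have e: "?e \<in> E \<inter> {u..v}" "\<And>w. w \<in> E \<inter> {u..v} \<Longrightarrow> \<bar>t - ?e\<bar> \<le> \<bar>t - w\<bar>"
    proof -
      have "closed (E \<inter> {u..v})" using E by (intro closed_Int) auto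
      note c = closest_point_exists[OF this that(1), of t]
      show "?e \<in> E \<inter> {u..v}" using c by blast
      show "\<bar>t - ?e\<bar> \<le> \<bar>t - w\<bar>" if "w \<in> E \<inter> {u..v}" for w
        using c that unfolding dist_real_def by blast
    qed
    have "h t = g ?e"
    proof (rule h)
      fix w assume w: "w \<in> E"
      show "\<not> (min t ?e < w \<and> w < max t ?e)"
        using e(1) e(2)[of w] w that(2) by (auto simp: min_def max_def split: if_splits)
    qed (use e in auto)
    then show ?thesis using e by blast
  qed
  have const: "h s = h t" if "E \<inter> {u..v} = {}" "s \<in> {u..v}" "t \<in> {u..v}" for u v s t
  proof -
    let ?e = "closest_point E t"
    have e: "?e \<in> E" "\<And>w. w \<in> E \<Longrightarrow> \<bar>t - ?e\<bar> \<le> \<bar>t - w\<bar>"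
      using closest_point_exists[OF E Ene, of t] by (auto simp: dist_real_def)
    have "h s = g ?e"
    proof (rule h[OF e(1)])
      fix w assume w: "w \<in> E"
      then have "w \<notin> {u..v}" "?e \<notin> {u..v}" using that(1) e(1) by auto
      then show "\<not> (min s ?e < w \<and> w < max s ?e)"
        using e(2)[OF w] that(2,3) by (auto simp: min_def max_def split: if_splits)
    qed
    then show ?thesis by (simp add: h_def)
  qed
  have hE: "h e = g e" if "e \<in> E" for e
    using that by (intro h) auto
  have img: "h ` {u..v} = T \<inter> g ` {u..v}" if ne: "E \<inter> {u..v} \<noteq> {}" and uv: "0 \<le> u" "v \<le> 1" for u v
  proof (intro equalityI subsetI)
    fix y assume "y \<in> h ` {u..v}"
    then obtain e where "e \<in> E \<inter> {u..v}" "y = g e" using near[OF ne] by blast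
    then show "y \<in> T \<inter> g ` {u..v}" by (auto simp: E_def)
  next
    fix y assume "y \<in> T \<inter> g ` {u..v}"
    then obtain e where e: "e \<in> {u..v}" "y = g e" "y \<in> T" by auto
    then have "e \<in> E" using uv by (auto simp: E_def)
    then show "y \<in> h ` {u..v}" using e hE by force
  qed
  have "convex (h ` {u..v})" if "0 \<le> u" "u \<le> v" "v \<le> 1" for u v
  proof (cases "E \<inter> {u..v} = {}")
    case True
    then have "h t = h u" if "t \<in> {u..v}" for t using const[OF True that, of u] that by auto
    then have "h ` {u..v} \<subseteq> {h u}" unfolding image_subset_iff singleton_iff by blast
    moreover have "h u \<in> h ` {u..v}" using \<open>u \<le> v\<close> by (intro imageI) simp
    ultimately have "h ` {u..v} = {h u}" by blast
    then show ?thesis by simp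
  next
    case False then show ?thesis using img[OF False] T(2) cvx that by (simp add: convex_Int)
  qed
  moreover have "h ` {0..1} = T"
  proof -
    have "E \<inter> {0..1} \<noteq> {}" using Ene E01 by auto
    then show ?thesis using img[of 0 1] T(4) by auto
  qed
  moreover have "continuous_on {0..1} h"
    unfolding continuous_on_iff
  proof (intro ballI allI impI)
    fix s d :: real assume s: "s \<in> {0..1}" and d: "d > 0"
    \<comment> \<open>If the interval between two parameters meets \<open>E\<close>, then both
      values of \<open>h\<close> are values of \<open>g\<close> at visits within that interval;
      otherwise they coincide. So \<open>h\<close> inherits the modulus of \<open>g\<close>.\<close>
    have "uniformly_continuous_on {0..1} g" using cont by (intro compact_uniformly_continuous) auto
    then obtain \<delta> where \<delta>: "\<delta> > 0" "\<And>a b. a \<in> {0..1} \<Longrightarrow> b \<in> {0..1} \<Longrightarrow> dist a b < \<delta> \<Longrightarrow> dist (g a) (g b) < d"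
      using d unfolding uniformly_continuous_on_def by metis
    have "dist (h t) (h s) < d" if t: "t \<in> {0..1}" "dist t s < \<delta>" for t
    proof (cases "E \<inter> {min s t..max s t} = {}")
      case True then show ?thesis using const[OF True, of t s] d by simp
    next
      case False
      obtain a where a: "a \<in> E \<inter> {min s t..max s t}" "h t = g a" using near[OF False, of t] by auto
      obtain b where b: "b \<in> E \<inter> {min s t..max s t}" "h s = g b" using near[OF False, of s] by auto
      have "dist a b \<le> dist t s" using a(1) b(1) by (auto simp: dist_real_def min_def max_def split: if_splits)
      moreover have "a \<in> {0..1}" "b \<in> {0..1}" using a(1) b(1) E01 by blast+
      ultimately show ?thesis unfolding a(2) b(2) using t(2) by (intro \<delta>(2)) auto
    qed
    then show "\<exists>\<delta>>0. \<forall>t\<in>{0..1}. dist t s < \<delta> \<longrightarrow> dist (h t) (h s) < d" using \<delta>(1) by blast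
  qed
  ultimately have "continuous_on {0..1} h \<and> h ` {0..1} = T
    \<and> (\<forall>u v. 0 \<le> u \<and> u \<le> v \<and> v \<le> 1 \<longrightarrow> convex (h ` {u..v}))"
    by blast
  then show ?thesis by blast
qed

section \<open>Transfer from the unit interval to the linear topological space\<close>

lemma convex_preserving_map:
  fixes f :: "'x::{real_vector,topological_space} \<Rightarrow> real" and h :: "real \<Rightarrow> 'a::real_normed_vector"
  assumes f: "linear f" "continuous_on UNIV f" and K: "convex K" "\<not> f constant_on K"
    and h: "continuous_on {0..1} h" "h ` {0..1} = T"
      "\<And>u v. 0 \<le> u \<Longrightarrow> u \<le> v \<Longrightarrow> v \<le> 1 \<Longrightarrow> convex (h ` {u..v})"
  shows "\<exists>k::'x \<Rightarrow> 'a. continuous_on UNIV k \<and> range k = T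
    \<and> (\<forall>L. L \<subseteq> K \<and> convex L \<longrightarrow> convex (k ` L)) \<and> k ` K = T"
proof -
  obtain x y where xy: "x \<in> K" "y \<in> K" "f x < f y"
    using K(2) unfolding constant_on_def by (metis linorder_neqE)
  \<comment> \<open>The values of \<open>f\<close> are rescaled so that \<open>x\<close> goes to 0
    and \<open>y\<close> to 1, then clamped to the unit interval. Convex sets still have intervals
    as images, and the image of \<open>K\<close> is the whole unit interval.\<close>
  define c where "c s = max 0 (min 1 ((s - f x) / (f y - f x)))" for s
  have c01: "c s \<in> {0..1}" for s by (auto simp: c_def)
  have cont_c: "continuous_on A c" for A unfolding c_def using xy by (intro continuous_intros) auto
  have conn: "connected (c ` f ` L)" if "convex L" for L
  proof -
    have "convex (f ` L)" using f(1) that by (rule convex_linear_image)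
    then show ?thesis by (intro connected_continuous_image cont_c convex_connected)
  qed
  define k where "k z = h (c (f z))" for z
  have "continuous_on UNIV (\<lambda>z. c (f z))"
    by (rule continuous_on_compose2[OF cont_c[of UNIV] f(2)]) auto
  then have "continuous_on UNIV k" unfolding k_def
    by (rule continuous_on_compose2[OF h(1)]) (use c01 in auto)
  moreover have "convex (k ` L)" if "convex L" for L
  proof -
    let ?I = "c ` f ` L"
    have kL: "k ` L = h ` ?I" by (auto simp: k_def)
    show ?thesis unfolding kL convex_contains_segment
    proof (intro ballI)
      fix p q assume "p \<in> h ` ?I" "q \<in> h ` ?I"
      then obtain a b where ab: "a \<in> ?I" "b \<in> ?I" "p = h a" "q = h b" by blast
      have "is_interval ?I" using conn[OF that] by (simp add: is_interval_connected_1)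
      then have sub: "{min a b..max a b} \<subseteq> ?I"
        using ab unfolding is_interval_1 by (auto simp: min_def max_def split: if_splits)
      have "a \<in> {0..1}" "b \<in> {0..1}" using ab(1,2) c01 by auto
      then have "convex (h ` {min a b..max a b})" by (intro h(3)) auto
      moreover have "p \<in> h ` {min a b..max a b}" "q \<in> h ` {min a b..max a b}" using ab by auto
      ultimately have "closed_segment p q \<subseteq> h ` {min a b..max a b}" unfolding convex_contains_segment by blast
      then show "closed_segment p q \<subseteq> h ` ?I" using image_mono[OF sub] by (rule subset_trans)
    qed
  qed
  moreover have kK: "k ` K = T"
  proof -
    have "0 \<in> c ` f ` K" using xy(1) by (intro image_eqI[of _ _ "f x"]) (auto simp: c_def)
    moreover have "1 \<in> c ` f ` K" using xy by (intro image_eqI[of _ _ "f y"]) (auto simp: c_def)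
    moreover have "is_interval (c ` f ` K)" using conn[OF K(1)] by (simp add: is_interval_connected_1)
    ultimately have "s \<in> c ` f ` K" if "s \<in> {0..1}" for s
      using that mem_is_interval_1_I[of "c ` f ` K" 0 1 s] by simp
    then have "{0..1} \<subseteq> c ` f ` K" by (rule subsetI)
    moreover have "c ` f ` K \<subseteq> {0..1}" by (intro image_subsetI c01)
    ultimately have "c ` f ` K = {0..1}" by (rule equalityI[rotated])
    moreover have "k ` K = h ` (c ` f ` K)" by (auto simp: k_def)
    ultimately show ?thesis using h(2) by simp
  qed
  moreover have "range k = T"
  proof
    show "range k \<subseteq> T" using c01 h(2) by (auto simp: k_def)
    show "T \<subseteq> range k" using kK by blast
  qed
  ultimately have "continuous_on UNIV k \<and> range k = T \<and> (\<forall>L. L \<subseteq> K \<and> convex L \<longrightarrow> convex (k ` L)) \<and> k ` K = T"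
    by simp
  then show ?thesis by blast
qed

lemma linear_functional_parts:
  fixes f :: "'b::complex_vector \<Rightarrow> complex"
  assumes "clinear f"
  shows "linear (\<lambda>x. Re (f x))" "linear (\<lambda>x. Im (f x))"
proof -
  have add: "f (x + y) = f x + f y" and scale: "f (c *\<^sub>C x) = c *\<^sub>C f x" for x y c
    using assms by (simp_all add: Vector_Spaces.linear_iff)
  have "f (r *\<^sub>R x) = r *\<^sub>R f x" for r x
    by (simp only: scaleR_scaleC scale)
  then show "linear (\<lambda>x. Re (f x))" "linear (\<lambda>x. Im (f x))"
    by (auto intro!: linearI simp: add)
qed

lemma convex_preserving_surjection:
  fixes f :: "'x::{real_vector,topological_space} \<Rightarrow> real" and T :: "'a::euclidean_space set"
  assumes "linear f" "continuous_on UNIV f" "convex K" "\<not> f constant_on K"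
    and T: "T \<noteq> {}" "compact T" "convex T"
  shows "\<exists>h::'x \<Rightarrow> 'a. continuous_on UNIV h \<and> range h = T
    \<and> (\<forall>L. L \<subseteq> K \<and> convex L \<longrightarrow> convex (h ` L)) \<and> h ` K = T"
proof -
  obtain g :: "real \<Rightarrow> 'a" where g: "continuous_on {0..1} g" "T \<subseteq> g ` {0..1}"
    "\<forall>u v. 0 \<le> u \<and> u \<le> v \<and> v \<le> 1 \<longrightarrow> convex (g ` {u..v})"
    using convex_curve_covering[OF T] by blast
  have "\<And>u v. 0 \<le> u \<Longrightarrow> u \<le> v \<Longrightarrow> v \<le> 1 \<Longrightarrow> convex (g ` {u..v})" using g(3) by simp
  from convex_curve_restrict[OF g(1) compact_imp_closed[OF T(2)] T(3,1) g(2) this]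
  obtain h :: "real \<Rightarrow> 'a" where h: "continuous_on {0..1} h" "h ` {0..1} = T"
    "\<forall>u v. 0 \<le> u \<and> u \<le> v \<and> v \<le> 1 \<longrightarrow> convex (h ` {u..v})"
    by blast
  have "\<And>u v. 0 \<le> u \<Longrightarrow> u \<le> v \<Longrightarrow> v \<le> 1 \<Longrightarrow> convex (h ` {u..v})" using h(3) by simp
  with assms(1-4) h(1,2) show ?thesis by (rule convex_preserving_map)
qed

theorem corollary3p4p1:
  "(\<forall>K :: 'a::real_linear_topological_space set.
      convex K \<and> (\<exists>f :: 'a \<Rightarrow> real. linear f \<and> continuous_on UNIV f \<and> \<not> f constant_on K) \<longrightarrow>
      (\<forall>T :: (real^2) set. T \<noteq> {} \<and> compact T \<and> convex T \<longrightarrow>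
        (\<exists>h :: 'a \<Rightarrow> real^2. continuous_on UNIV h \<and> range h = T \<and>
          (\<forall>L. L \<subseteq> K \<and> convex L \<longrightarrow> convex (h ` L)) \<and> h ` K = T))) \<and>
   (\<forall>K :: 'b::complex_linear_topological_space set.
      convex K \<and> (\<exists>f :: 'b \<Rightarrow> complex. clinear f \<and> continuous_on UNIV f \<and> \<not> f constant_on K) \<longrightarrow>
      (\<forall>T :: (real^2) set. T \<noteq> {} \<and> compact T \<and> convex T \<longrightarrow>
        (\<exists>h :: 'b \<Rightarrow> real^2. continuous_on UNIV h \<and> range h = T \<and>
          (\<forall>L. L \<subseteq> K \<and> convex L \<longrightarrow> convex (h ` L)) \<and> h ` K = T)))"
proof (intro conjI allI impI; (elim conjE exE)?)
  fix K :: "'a set" and f :: "'a \<Rightarrow> real" and T :: "(real^2) set"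
  assume "convex K" "linear f" "continuous_on UNIV f" "\<not> f constant_on K" "T \<noteq> {}" "compact T" "convex T"
  then show "\<exists>h :: 'a \<Rightarrow> real^2. continuous_on UNIV h \<and> range h = T \<and>
      (\<forall>L. L \<subseteq> K \<and> convex L \<longrightarrow> convex (h ` L)) \<and> h ` K = T"
    by (intro convex_preserving_surjection)
next
  fix K :: "'b set" and f :: "'b \<Rightarrow> complex" and T :: "(real^2) set"
  assume K: "convex K" and f: "clinear f" "continuous_on UNIV f" "\<not> f constant_on K"
    and T: "T \<noteq> {}" "compact T" "convex T"
  \<comment> \<open>If both parts were constant on \<open>K\<close>, so would be \<open>f\<close>; a
    non-constant part reduces the complex case to a real functional.\<close>
  have "\<not> (\<lambda>x. Re (f x)) constant_on K \<or> \<not> (\<lambda>x. Im (f x)) constant_on K"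
    using f(3) unfolding constant_on_def by (metis complex_eqI)
  then obtain r :: "'b \<Rightarrow> real" where "linear r" "continuous_on UNIV r" "\<not> r constant_on K"
    using linear_functional_parts[OF f(1)] continuous_on_Re[OF f(2)] continuous_on_Im[OF f(2)] by blast
  with K T show "\<exists>h :: 'b \<Rightarrow> real^2. continuous_on UNIV h \<and> range h = T \<and>
      (\<forall>L. L \<subseteq> K \<and> convex L \<longrightarrow> convex (h ` L)) \<and> h ` K = T"
    by (intro convex_preserving_surjection)
qed

end
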